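(* Let $n>0$ and let $\Theta:L_{n+1}\to L_{n+1}$ be the map $\Theta(\pi)=s(\pi)\,\Psi\bigl(s(\pi)^{-1}\pi\bigr)$ defined in the context below. Then $\Theta$ is a bijection of $L_{n+1}$ onto itself, and for every $\pi\in L_{n+1}$, \[ \operatorname{nrmaj}_{L_{n+1}}(\pi)=\ell_L(\Theta(\pi))\qquad\text{and}\qquad \operatorname{Neg}(\pi^{-1})=\operatorname{Neg}(\Theta(\pi)^{-1}). \]
   Context: \textbf{Groups.} $B_m$ is the group of bijections $\sigma$ of $\{\pm1,\dots,\pm m\}$ with $\sigma(-i)=-\sigma(i)$, under composition $(\sigma\tau)(i)=\sigma(\tau(i))$; write $\sigma=[\sigma(1),\dots,\sigma(m)]$ (window notation). $S_m\subset B_m$ are the elements with all $\sigma(i)>0$, and $A_m\subset S_m$ the even permutations. $L_m\subset B_m$ is the subgroup (index 2) of signed even permutations: those $\sigma$ for which $i\mapsto|\sigma(i)|$ is an even permutation. Let $s_i=(i,i+1)$ be the adjacent transpositions, and for $1\le i\le n-1$ let $a_i=s_1s_{i+1}\in A_{n+1}$ (these generate $A_{n+1}$). \textbf{Statistics.} For a word $x_1\cdots x_m$ over a totally ordered alphabet, $\operatorname{inv}=\#\{i<j: x_i>x_j\}$. For $\sigma\in B_m$ (viewed as the word $\sigma(1)\cdots\sigma(m)$): $\operatorname{del}_B(\sigma)=\#\{2\le j\le m:\sigma(i)>\sigma(j)\text{ for all }1\le i<j\}$; $\operatorname{Neg}(\sigma^{-1})=\{-\sigma(i): 1\le i\le m,\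 \sigma(i)<0\}$; and the $L$-length is $\ell_L(\sigma)=\operatorname{inv}(\sigma)-\operatorname{del}_B(\sigma)+\sum_{i\in\operatorname{Neg}(\sigma^{-1})}i$. For $\pi\in L_{n+1}$: $\operatorname{Des}_A(\pi)=\{1\le i\le n-1:\ell_L(\pi a_i)\le\ell_L(\pi)\}$, $\operatorname{des}_A(\pi)=|\operatorname{Des}_A(\pi)|$, $\operatorname{rmaj}_{L_{n+1}}(\pi)=\sum_{i\in\operatorname{Des}_A(\pi)}(n-i)$, and $\operatorname{nrmaj}_{L_{n+1}}(\pi)=\operatorname{rmaj}_{L_{n+1}}(\pi)+\sum_{i\in\operatorname{Neg}(\pi^{-1})}i$. \textbf{The map $s$.} For $\pi\in L_{n+1}$, $\operatorname{sort}(\pi)$ is the element of $B_{n+1}$ whose window lists the values $\pi(1),\dots,\pi(n+1)$ in increasing order. Define $s(\pi)=\operatorname{sort}(\pi)$ if $\sum_{i\in\operatorname{Neg}(\pi^{-1})}i$ is even and $s(\pi)=\operatorname{sort}(\pi)s_1$ otherwise. (It is known that $s(\pi)\in L_{n+1}$ and $s(\pi)^{-1}\pi\in A_{n+1}$.) \textbf{Canonical presentations.} For $j\ge1$ let $R_j^S=\{1,\,s_j,\,s_js_{j-1},\dots,s_js_{j-1}\cdots s_1\}$ and $R_j^A=\{1,\,a_j,\,a_ja_{j-1},\dots,a_j\cdots a_2,\,a_j\cdots a_2a_1,\,a_j\cdots a_2a_1^{-1}\}$. Every $w\in S_n$ has a unique factorization $w=w_1\cdots w_{n-1}$ with $w_j\in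 R_j^S$, and every $v\in A_{n+1}$ has a unique factorization $v=v_1\cdots v_{n-1}$ with $v_j\in R_j^A$ (the $S$- and $A$-canonical presentations). \textbf{The maps $f$ and $g_u$.} Define $f:R_j^A\to R_j^S$ by $f(1)=1$, $f(a_ja_{j-1}\cdots a_\ell)=s_js_{j-1}\cdots s_\ell$ for $\ell\ge2$, and $f(a_j\cdots a_2a_1)=f(a_j\cdots a_2a_1^{-1})=s_j\cdots s_1$; extend to $f:A_{n+1}\to S_n$ by $f(v)=f(v_1)\cdots f(v_{n-1})$ using the $A$-canonical presentation. For $u\in A_{n+1}$ with $A$-canonical presentation $u_1\cdots u_{n-1}$, define $g_u:R_j^S\to R_j^A$ by $g_u(1)=1$, $g_u(s_j\cdots s_\ell)=a_j\cdots a_\ell$ for $\ell\ge2$, $g_u(s_j\cdots s_1)=u_j$; extend to $g_u:S_n\to A_{n+1}$ by $g_u(w)=g_u(w_1)\cdots g_u(w_{n-1})$ using the $S$-canonical presentation. \textbf{Foata's transformation.} For a word $r=x_1\cdots x_m$ over a totally ordered alphabet, $\Phi(r)$ is computed as follows: set $r'_1=x_1$; for $i=1,\dots,m-1$: if the last letter of $r'_i$ is $\le x_{i+1}$ (resp. $>x_{i+1}$), cut $r'_i$ after every letter $\le x_{i+1}$ (resp. $>x_{i+1}$); in each resulting compartment move its last letter to the beginning of the compartment, obtaining $t'_i$; set $r'_{i+1}=t'_ix_{i+1}$. Then $\Phi(r)=r'_m$. Let $\operatorname{rev}(x_1\cdots x_m)=x_m\cdots x_1$ and $\overleftarrow{\Phi}=\operatorname{rev}\circ\Phi\circ\operatorname{rev}$;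 applied to $w\in S_n$ viewed as the word $w(1)\cdots w(n)$, it yields an element of $S_n$. \textbf{The maps $\Psi$ and $\Theta$.} $\Psi:A_{n+1}\to A_{n+1}$ is $\Psi(v)=g_v\bigl(\overleftarrow{\Phi}(f(v))\bigr)$, and $\Theta(\pi)=s(\pi)\,\Psi(s(\pi)^{-1}\pi)$ for $\pi\in L_{n+1}$.
   Formalization: The map s is defined by the parity of the sum of (i−1) over Neg(π^{-1}) rather than of the sum of i; with the printed rule s(π) is not in L_{n+1} when |Neg(π^{-1})| is odd, e.g. π=[-1,2] gives s(π)=[2,-1], and Ψ is undefined there. *)

theory Defs
  imports "HOL-Combinatorics.Permutations"
begin

text \<open>
  Signed permutations of \<open>{\<plusminus>1, \<dots>, \<plusminus>m}\<close> are functions on the integers that fix every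
  integer outside this set, so that the product is \<open>\<circ>\<close>, the inverse is \<^const>\<open>inv\<close>, and
  \<open>B\<^sub>n \<subseteq> B\<^sub>n\<^sub>+\<^sub>1\<close> holds literally.
\<close>

definition signed_perms :: "nat \<Rightarrow> (int \<Rightarrow> int) set" where
  "signed_perms m = {\<sigma>. \<sigma> permutes {- int m..int m} - {0} \<and> (\<forall>i. \<sigma> (- i) = - \<sigma> i)}"

definition abs_perm :: "nat \<Rightarrow> (int \<Rightarrow> int) \<Rightarrow> int \<Rightarrow> int" where
  "abs_perm m \<sigma> = (\<lambda>i. if i \<in> {1..int m} then \<bar>\<sigma> i\<bar> else i)"

definition signed_even_perms :: "nat \<Rightarrow> (int \<Rightarrow> int) set" where
  "signed_even_perms m = {\<sigma> \<in> signed_perms m. evenperm (abs_perm m \<sigma>)}"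

definition window :: "nat \<Rightarrow> (int \<Rightarrow> int) \<Rightarrow> int list" where
  "window m \<sigma> = map \<sigma> [1..int m]"

definition of_window :: "int list \<Rightarrow> int \<Rightarrow> int" where
  "of_window xs = (\<lambda>i. if i = 0 \<or> \<bar>i\<bar> > int (length xs) then i
                        else sgn i * xs ! (nat \<bar>i\<bar> - 1))"

definition gen_s :: "nat \<Rightarrow> int \<Rightarrow> int" where
  "gen_s i = transpose (int i) (int i + 1) \<circ> transpose (- int i) (- (int i + 1))"

definition gen_a :: "nat \<Rightarrow> int \<Rightarrow> int" where
  "gen_a i = gen_s 1 \<circ> gen_s (i + 1)"

definition group_prod :: "(int \<Rightarrow> int) list \<Rightarrow> int \<Rightarrow> int" where
  "group_prod xs = foldr (\<circ>) xs id"


subsection \<open>Statistics\<close>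

definition word_inv :: "'a::linorder list \<Rightarrow> nat" where
  "word_inv xs = card {(i, j). i < j \<and> j < length xs \<and> xs ! i > xs ! j}"

definition del_B :: "nat \<Rightarrow> (int \<Rightarrow> int) \<Rightarrow> nat" where
  "del_B m \<sigma> = card {j \<in> {2..int m}. \<forall>i \<in> {1..<j}. \<sigma> i > \<sigma> j}"

text \<open>\<open>Neg_inv m \<sigma>\<close> is \<open>Neg(\<sigma>\<^sup>-\<^sup>1)\<close>, expressed through the window of \<open>\<sigma>\<close>.\<close>

definition Neg_inv :: "nat \<Rightarrow> (int \<Rightarrow> int) \<Rightarrow> int set" where
  "Neg_inv m \<sigma> = {- \<sigma> i | i. 1 \<le> i \<and> i \<le> int m \<and> \<sigma> i < 0}"

lemma Neg_inv_eq:
  assumes "\<sigma> \<in> signed_perms m"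
  shows "Neg_inv m \<sigma> = {i \<in> {1..int m}. inv \<sigma> i < 0}"
proof -
  let ?D = "{- int m..int m} - {0}"
  have p: "\<sigma> permutes ?D" and odd: "\<And>i. \<sigma> (- i) = - \<sigma> i"
    using assms by (auto simp: signed_perms_def)
  show ?thesis
  proof (intro equalityI subsetI)
    fix k assume "k \<in> Neg_inv m \<sigma>"
    then obtain i where i: "k = - \<sigma> i" "1 \<le> i" "i \<le> int m" "\<sigma> i < 0"
      by (auto simp: Neg_inv_def)
    have "\<sigma> i \<in> ?D" using permutes_in_image[OF p, of i] i by auto
    moreover have "inv \<sigma> k = - i"
      using permutes_inverses(2)[OF p, of "- i"] i(1) by (simp add: odd)
    ultimately show "k \<in> {i \<in> {1..int m}. inv \<sigma> i < 0}" using i by auto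
  next
    fix k assume k: "k \<in> {i \<in> {1..int m}. inv \<sigma> i < 0}"
    have "inv \<sigma> k \<in> ?D" using permutes_in_image[OF permutes_inv[OF p], of k] k by auto
    moreover have "\<sigma> (- inv \<sigma> k) = - k"
      by (simp add: odd permutes_inverses(1)[OF p])
    ultimately show "k \<in> Neg_inv m \<sigma>"
      using k unfolding Neg_inv_def by (intro CollectI exI[of _ "- inv \<sigma> k"]) auto
  qed
qed

definition ell_L :: "nat \<Rightarrow> (int \<Rightarrow> int) \<Rightarrow> int" where
  "ell_L m \<sigma> = int (word_inv (window m \<sigma>)) - int (del_B m \<sigma>) + (\<Sum>i \<in> Neg_inv m \<sigma>. i)"

text \<open>From here on the parameter is \<open>n\<close>, while the permutations live in \<open>L\<^sub>n\<^sub>+\<^sub>1\<close>.\<close>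

definition Des_A :: "nat \<Rightarrow> (int \<Rightarrow> int) \<Rightarrow> nat set" where
  "Des_A n \<pi> = {i \<in> {1..n - 1}. ell_L (n + 1) (\<pi> \<circ> gen_a i) \<le> ell_L (n + 1) \<pi>}"

definition rmaj :: "nat \<Rightarrow> (int \<Rightarrow> int) \<Rightarrow> int" where
  "rmaj n \<pi> = (\<Sum>i \<in> Des_A n \<pi>. int n - int i)"

definition nrmaj :: "nat \<Rightarrow> (int \<Rightarrow> int) \<Rightarrow> int" where
  "nrmaj n \<pi> = rmaj n \<pi> + (\<Sum>i \<in> Neg_inv (n + 1) \<pi>. i)"


subsection \<open>The map \<open>s\<close>\<close>

definition sort_perm :: "nat \<Rightarrow> (int \<Rightarrow> int) \<Rightarrow> int \<Rightarrow> int" where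
  "sort_perm m \<pi> = of_window (sort (window m \<pi>))"

text \<open>
  Write \<open>k\<close> for the size of \<open>Neg(\<pi>\<^sup>-\<^sup>1)\<close>. The absolute values of the window of \<open>sort(\<pi>)\<close> are the
  elements of \<open>Neg(\<pi>\<^sup>-\<^sup>1)\<close> in decreasing order followed by the remaining numbers in increasing
  order; this word has \<open>\<Sum>i - k = \<Sum>(i - 1)\<close> inversions, the sums being over \<open>Neg(\<pi>\<^sup>-\<^sup>1)\<close>. Hence it
  is the parity of \<open>\<Sum>(i - 1)\<close>, and not that of \<open>\<Sum>i\<close>, which decides whether \<open>sort(\<pi>)\<close> or
  \<open>sort(\<pi>) s\<^sub>1\<close> is the one lying in \<open>L\<^sub>n\<^sub>+\<^sub>1\<close>; for instance \<open>\<pi> = [-1, 2]\<close> is already sorted and even,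
  although \<open>\<Sum>i = 1\<close>.
\<close>

definition s_map :: "nat \<Rightarrow> (int \<Rightarrow> int) \<Rightarrow> int \<Rightarrow> int" where
  "s_map n \<pi> = (if even (\<Sum>i \<in> Neg_inv (n + 1) \<pi>. i - 1) then sort_perm (n + 1) \<pi>
                else sort_perm (n + 1) \<pi> \<circ> gen_s 1)"


subsection \<open>Canonical presentations\<close>

text \<open>\<open>s_desc j l\<close> is \<open>s\<^sub>j s\<^sub>j\<^sub>-\<^sub>1 \<dots> s\<^sub>l\<close>, which is the identity for \<open>l = j + 1\<close>; likewise \<open>a_desc\<close>.\<close>

definition s_desc :: "nat \<Rightarrow> nat \<Rightarrow> int \<Rightarrow> int" where
  "s_desc j l = group_prod (map gen_s (rev [l..<j + 1]))"

definition a_desc :: "nat \<Rightarrow> nat \<Rightarrow> int \<Rightarrow> int" where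
  "a_desc j l = group_prod (map gen_a (rev [l..<j + 1]))"

definition a_desc_inv :: "nat \<Rightarrow> int \<Rightarrow> int" where
  "a_desc_inv j = a_desc j 2 \<circ> inv (gen_a 1)"

definition R_S :: "nat \<Rightarrow> (int \<Rightarrow> int) set" where
  "R_S j = {s_desc j l | l. 1 \<le> l \<and> l \<le> j + 1}"

definition R_A :: "nat \<Rightarrow> (int \<Rightarrow> int) set" where
  "R_A j = {a_desc j l | l. 1 \<le> l \<and> l \<le> j + 1} \<union> {a_desc_inv j}"

text \<open>The factor with index \<open>j\<close> is stored at list position \<open>j - 1\<close>.\<close>

definition S_canon :: "nat \<Rightarrow> (int \<Rightarrow> int) \<Rightarrow> (int \<Rightarrow> int) list" where
  "S_canon n w = (THE ws. length ws = n - 1 \<and> (\<forall>j \<in> {1..n - 1}. ws ! (j - 1) \<in> R_S j)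
                          \<and> group_prod ws = w)"

definition A_canon :: "nat \<Rightarrow> (int \<Rightarrow> int) \<Rightarrow> (int \<Rightarrow> int) list" where
  "A_canon n v = (THE vs. length vs = n - 1 \<and> (\<forall>j \<in> {1..n - 1}. vs ! (j - 1) \<in> R_A j)
                          \<and> group_prod vs = v)"


subsection \<open>The maps \<open>f\<close> and \<open>g\<^sub>u\<close>\<close>

definition f_factor :: "nat \<Rightarrow> (int \<Rightarrow> int) \<Rightarrow> int \<Rightarrow> int" where
  "f_factor j r = (if r = a_desc_inv j then s_desc j 1
                   else s_desc j (THE l. 1 \<le> l \<and> l \<le> j + 1 \<and> r = a_desc j l))"

definition f_map :: "nat \<Rightarrow> (int \<Rightarrow> int) \<Rightarrow> int \<Rightarrow> int" where
  "f_map n v = group_prod (map (\<lambda>j. f_factor j (A_canon n v ! (j - 1))) [1..<n])"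

definition g_factor :: "nat \<Rightarrow> (int \<Rightarrow> int) \<Rightarrow> nat \<Rightarrow> (int \<Rightarrow> int) \<Rightarrow> int \<Rightarrow> int" where
  "g_factor n u j r = (if r = s_desc j 1 then A_canon n u ! (j - 1)
                       else a_desc j (THE l. 2 \<le> l \<and> l \<le> j + 1 \<and> r = s_desc j l))"

definition g_map :: "nat \<Rightarrow> (int \<Rightarrow> int) \<Rightarrow> (int \<Rightarrow> int) \<Rightarrow> int \<Rightarrow> int" where
  "g_map n u w = group_prod (map (\<lambda>j. g_factor n u j (S_canon n w ! (j - 1))) [1..<n])"


subsection \<open>Foata's transformation\<close>

fun cut_after :: "('a \<Rightarrow> bool) \<Rightarrow> 'a list \<Rightarrow> 'a list list" where
  "cut_after P [] = []"
| "cut_after P (y # ys) =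
     (if P y then [y] # cut_after P ys
      else (case cut_after P ys of [] \<Rightarrow> [[y]] | c # cs \<Rightarrow> (y # c) # cs))"

definition last_to_front :: "'a list \<Rightarrow> 'a list" where
  "last_to_front c = last c # butlast c"

definition foata_step :: "'a::linorder list \<Rightarrow> 'a \<Rightarrow> 'a list" where
  "foata_step r x =
     concat (map last_to_front (cut_after (if last r \<le> x then (\<lambda>y. y \<le> x) else (\<lambda>y. y > x)) r))
     @ [x]"

fun foata :: "'a::linorder list \<Rightarrow> 'a list" where
  "foata [] = []"
| "foata (x # xs) = foldl foata_step [x] xs"

definition rev_foata :: "'a::linorder list \<Rightarrow> 'a list" where
  "rev_foata = rev \<circ> foata \<circ> rev"


subsection \<open>The maps \<open>\<Psi>\<close> and \<open>\<Theta>\<close>\<close>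

definition Psi :: "nat \<Rightarrow> (int \<Rightarrow> int) \<Rightarrow> int \<Rightarrow> int" where
  "Psi n v = g_map n v (of_window (rev_foata (window n (f_map n v))))"

definition Theta :: "nat \<Rightarrow> (int \<Rightarrow> int) \<Rightarrow> int \<Rightarrow> int" where
  "Theta n \<pi> = s_map n \<pi> \<circ> Psi n (inv (s_map n \<pi>) \<circ> \<pi>)"

end

theory Submission
  imports Defs
begin

text \<open>
  A bubble-sort pass \<open>bubble\<close> turns a window of length \<open>n + 1\<close> into a word of length \<open>n\<close>, and it is the
  common description of everything involved. It satisfies \<open>inv(x) - del(x) = inv(bubble(x))\<close>, hence
  \<open>\<ell>\<^sub>L(\<pi>)\<close> is the number of inversions of \<open>bubble(\<pi>)\<close> plus the sum over \<open>Neg(\<pi>\<^sup>-\<^sup>1)\<close>; the set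
  \<open>Des\<^sub>A(\<pi>)\<close> is the ordinary descent set of \<open>bubble(\<pi>)\<close>; and \<open>f(v)\<close> is \<open>bubble(v)\<close> with all letters
  lowered by one. A pass commutes with increasing maps and does not distinguish the two smallest
  letters, so left multiplication by \<open>s(\<pi>)\<close> is harmless. Equidistribution is thereby reduced to
  Foata's theorem for the word \<open>f(v)\<close>.

  The \<open>j\<close>-th canonical factor of \<open>w \<in> S\<^sub>n\<close> is \<open>s\<^sub>j \<dots> s\<^sub>1\<close> iff \<open>j + 1\<close> is a left-to-right minimum of
  \<open>w\<close>. The reversed Foata transformation preserves the set of left-to-right minima, because each step
  keeps the relative order of the letters below the appended one. Therefore \<open>g\<^sub>v\<close> inserts exactly the
  factors forgotten by \<open>f\<close>, which gives \<open>f(\<Psi>(v)) = rev \<Phi> rev (f(v))\<close> and injectivity of \<open>\<Psi>\<close>.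
  Finally \<open>s(\<pi>)\<close> depends only on the set of window values, which \<open>\<Theta>\<close> preserves.
\<close>

subsection \<open>Inversions and bubble passes\<close>

lemma word_inv_Nil [simp]: "word_inv [] = 0"
  by (simp add: word_inv_def)

text \<open>Inversions are split by whether their left position is 0. This recursion replaces the
  set of index pairs in everything that follows.\<close>

lemma word_inv_Cons [simp]:
  "word_inv (x # xs) = length (filter (\<lambda>y. y < x) xs) + word_inv xs"
proof -
  let ?A = "{i. i < length xs \<and> xs ! i < x}"
  let ?I = "{(i, j). i < j \<and> j < length xs \<and> xs ! i > xs ! j}"
  have fin: "finite ?I" by (rule finite_subset[of _ "{..<length xs} \<times> {..<length xs}"]) auto
  have "{(i, j). i < j \<and> j < length (x # xs) \<and> (x # xs) ! i > (x # xs) ! j}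
      = (\<lambda>j. (0, Suc j)) ` ?A \<union> map_prod Suc Suc ` ?I" (is "?L = ?R")
  proof (intro equalityI subsetI)
    fix p assume "p \<in> ?L"
    then obtain i j where p: "p = (i, j)" "i < j" "j < length (x # xs)" "(x # xs) ! i > (x # xs) ! j"
      by auto
    then obtain j' where j: "j = Suc j'" by (cases j) auto
    show "p \<in> ?R"
    proof (cases i)
      case 0
      then show ?thesis using p j by auto
    next
      case (Suc i')
      then have "(i', j') \<in> ?I" using p j by auto
      then show ?thesis using p(1) j Suc by (metis (no_types, lifting) UnI2 imageI map_prod_simp)
    qed
  qed auto
  moreover have "card ((\<lambda>j. (0, Suc j)) ` ?A \<union> map_prod Suc Suc ` ?I) = card ?A + card ?I"
    using fin by (subst card_Un_disjoint) (auto simp: card_image inj_on_def)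
  ultimately show ?thesis by (simp add: word_inv_def length_filter_conv_card)
qed

lemma word_inv_append:
  "word_inv (xs @ ys) = word_inv xs + word_inv ys + (\<Sum>x\<leftarrow>xs. length (filter (\<lambda>y. y < x) ys))"
  by (induction xs) auto

lemma word_inv_snoc: "word_inv (xs @ [x]) = word_inv xs + length (filter (\<lambda>y. x < y) xs)"
  by (induction xs) auto

lemma length_filter_mset_cong: "mset xs = mset ys \<Longrightarrow> length (filter P xs) = length (filter P ys)"
  by (metis mset_filter size_mset)

lemma sum_list_map_mset_cong:
  assumes "mset xs = mset ys" shows "(\<Sum>x\<leftarrow>xs. f x) = (\<Sum>x\<leftarrow>ys. f x :: nat)"
proof -
  have "mset (map f xs) = mset (map f ys)" using assms by simp
  then show ?thesis by (metis sum_mset_sum_list)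
qed

text \<open>Every letter of \<open>us\<close> sees the same multiset to its right and every letter
  of \<open>vs\<close> the same multiset to its left, so only the pair \<open>p\<close>,
  \<open>q\<close> changes its status.\<close>

lemma word_inv_swap:
  assumes "p < q"
  shows "word_inv (us @ q # p # vs) = Suc (word_inv (us @ p # q # vs))"
proof -
  have "length (filter (\<lambda>y. y < u) (q # p # vs)) = length (filter (\<lambda>y. y < u) (p # q # vs))" for u
    by (intro length_filter_mset_cong) simp
  then show ?thesis using assms unfolding word_inv_append[of us] by simp
qed

lemma word_inv_map_strict_mono_on:
  assumes "strict_mono_on A f" "set xs \<subseteq> A"
  shows "word_inv (map f xs) = word_inv xs"
  using assms(2)
proof (induction xs)
  case (Cons x xs)
  have "filter (\<lambda>y. f y < f x) xs = filter (\<lambda>y. y < x) xs"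
    using Cons.prems strict_mono_on_less[OF assms(1)] by (intro filter_cong) auto
  then show ?case using Cons by (simp add: filter_map o_def)
qed simp

text \<open>One bubble-sort pass that carries the smallest letter seen so far to the end and discards it:
  position \<open>i\<close> of \<open>bubble xs\<close> holds \<open>max (min x\<^sub>1 \<dots> x\<^sub>i) x\<^sub>i\<^sub>+\<^sub>1\<close>.\<close>

fun bubble :: "'a::linorder list \<Rightarrow> 'a list" where
  "bubble (x # y # ys) = max x y # bubble (min x y # ys)"
| "bubble _ = []"

text \<open>The minimum read so far is all that a pass remembers of a prefix.\<close>

lemma bubble_append:
  "us \<noteq> [] \<Longrightarrow> bubble (us @ ys) = bubble us @ bubble (Min (set us) # ys)"
proof (induction us rule: bubble.induct)
  case (1 x y zs)
  have "Min (set (min x y # zs)) = Min (set (x # y # zs))"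
    by (cases "zs = []") (simp_all add: min.assoc)
  then show ?case using 1 by simp
qed auto

lemma bubble_snoc: "xs \<noteq> [] \<Longrightarrow> bubble (xs @ [z]) = bubble xs @ [max (Min (set xs)) z]"
  by (simp add: bubble_append)

lemma length_bubble: "length (bubble xs) = length xs - 1"
  by (induction xs rule: bubble.induct) auto

text \<open>Only the letter carried to the end, the minimum, is lost. The multiset form transfers
  both letter counts and distinctness.\<close>

lemma mset_bubble: "xs \<noteq> [] \<Longrightarrow> add_mset (Min (set xs)) (mset (bubble xs)) = mset xs"
proof (induction xs rule: rev_induct)
  case (snoc z xs)
  show ?case
  proof (cases "xs = []")
    case False
    define m where "m = Min (set xs)"
    have "Min (set (xs @ [z])) = min z m" using False by (simp add: m_def)
    moreover have "add_mset m (mset (bubble xs)) = mset xs"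
      using snoc.IH[OF False] by (simp add: m_def)
    moreover have "bubble (xs @ [z]) = bubble xs @ [max m z]"
      using False by (simp add: bubble_snoc m_def)
    ultimately show ?thesis by (cases "z \<le> m") (auto simp: min_def max_def add_mset_commute)
  qed simp
qed simp

lemma set_bubble_subset: "set (bubble xs) \<subseteq> set xs"
proof (cases "xs = []")
  case False
  then have "mset (bubble xs) \<subseteq># mset xs"
    using mset_bubble[OF False] by (metis add_mset_add_single mset_subset_eq_add_left)
  then show ?thesis by (metis set_mset_mono set_mset_mset)
qed simp

lemma distinct_bubble: assumes "distinct xs" shows "distinct (bubble xs)"
proof (cases "xs = []")
  case False
  have "count (mset (bubble xs)) a \<le> 1" for a
  proof -
    have "count (mset (bubble xs)) a \<le> count (mset xs) a"
      using mset_bubble[OF False] by (metis count_add_mset le_Suc_eq order_refl)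
    also have "\<dots> \<le> 1" using assms by (simp add: distinct_count_atmost_1)
    finally show ?thesis .
  qed
  then show ?thesis
    by (metis count_mset_0_iff distinct_count_atmost_1 le_SucE le_zero_eq One_nat_def)
qed simp

text \<open>Increasing maps commute with \<open>max\<close> and \<open>min\<close>. This will be
  applied to \<open>sort_perm\<close>, which is increasing on the positions of the window.\<close>

lemma bubble_map_strict_mono_on:
  assumes "strict_mono_on A f" "set xs \<subseteq> A"
  shows "bubble (map f xs) = map f (bubble xs)"
  using assms(2)
proof (induction xs rule: bubble.induct)
  case (1 x y zs)
  have "max (f x) (f y) = f (max x y)" "min (f x) (f y) = f (min x y)"
    using 1(2) strict_mono_on_leD[OF assms(1)] by (auto simp: max_def min_def) (metis antisym linear)+
  moreover have "set (min x y # zs) \<subseteq> A" using 1(2) by (auto simp: min_def)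
  ultimately show ?case using 1(1) by simp
qed auto

text \<open>A bubble pass forgets which of the two smallest letters is which.\<close>

lemma bubble_transpose_min:
  fixes a b :: "'a::linorder"
  assumes "distinct xs" "a \<in> set xs" "b \<in> set xs" "a < b" "\<And>x. x \<in> set xs \<Longrightarrow> x \<noteq> a \<Longrightarrow> b \<le> x"
  shows "bubble (map (transpose a b) xs) = bubble xs"
  using assms
proof (induction xs rule: bubble.induct)
  case (1 x y zs)
  show ?case
  proof (cases "{x, y} = {a, b}")
    case True
    \<comment> \<open>The pass compares \<open>a\<close> with \<open>b\<close> here, and
      \<open>max\<close> and \<open>min\<close> are symmetric.\<close>
    then have "a \<notin> set zs" "b \<notin> set zs" using 1(2) by auto
    then have "map (transpose a b) zs = zs" by (intro map_idI) (auto simp: transpose_def)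
    then show ?thesis using True \<open>a < b\<close> by (auto simp: doubleton_eq_iff max_def min_def)
  next
    case False
    let ?t = "transpose a b"
    have ge: "b < z" if "z \<in> {x, y}" "z \<noteq> a" "z \<noteq> b" for z
      using 1(6)[of z] that by auto
    consider "x \<in> {a, b}" "y \<notin> {a, b}" "x < y" | "x \<notin> {a, b}" "y \<in> {a, b}" "y < x"
      | "x \<notin> {a, b}" "y \<notin> {a, b}"
      using False 1(2) ge[of x] ge[of y] \<open>a < b\<close> by fastforce
    \<comment> \<open>At most one of \<open>a\<close>, \<open>b\<close> takes part in this
      comparison, against a letter above both, so it is carried on. Both letters are therefore still
      present for the induction hypothesis.\<close>
    then have mm: "max (?t x) (?t y) = max x y \<and> min (?t x) (?t y) = ?t (min x y) \<and>
        ({a, b} \<inter> {x, y} \<subseteq> {min x y})"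
      by cases (use ge[of x] ge[of y] \<open>a < b\<close> in \<open>auto simp: transpose_def max_def min_def\<close>)
    have "distinct (min x y # zs)" using 1(2) by (auto simp: min_def)
    moreover have "a \<in> set (min x y # zs)" "b \<in> set (min x y # zs)"
      using 1(3,4) mm by auto
    moreover have "z \<in> set (min x y # zs) \<Longrightarrow> z \<noteq> a \<Longrightarrow> b \<le> z" for z
      using 1(6)[of z] by (auto simp: min_def split: if_splits)
    ultimately show ?thesis using 1(1)[OF _ _ _ \<open>a < b\<close>] mm by simp
  qed
qed auto

text \<open>Among the three letters \<open>c\<close>, \<open>y\<close>, \<open>z\<close> with \<open>c\<close> the carried one, both sides say that \<open>z\<close>
  is not the largest.\<close>

lemma bubble_descent_iff:
  assumes "distinct (us @ y # z # vs)" "us \<noteq> []"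
  shows "word_inv (bubble (us @ z # y # vs)) \<le> word_inv (bubble (us @ y # z # vs)) \<longleftrightarrow>
    bubble (us @ y # z # vs) ! (length us - 1) > bubble (us @ y # z # vs) ! length us"
proof -
  define c where "c = Min (set us)"
  have "c \<in> set us" using assms(2) by (simp add: c_def)
  then have ne: "c \<noteq> y" "c \<noteq> z" "y \<noteq> z" using assms(1) by auto
  have e1: "bubble (us @ y # z # vs) =
      bubble us @ max c y # max (min c y) z # bubble (min (min c y) z # vs)"
    using bubble_append[OF assms(2)] by (simp add: c_def)
  have e2: "bubble (us @ z # y # vs) =
      bubble us @ max c z # max (min c z) y # bubble (min (min c y) z # vs)"
    using bubble_append[OF assms(2)] by (simp add: c_def min.assoc min.commute min.left_commute)
  have l: "length (bubble us) = length us - 1" "length us = Suc (length us - 1)"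
    using assms(2) by (auto simp: length_bubble)
  have n1: "bubble (us @ y # z # vs) ! (length us - 1) = max c y"
    unfolding e1 l(1)[symmetric] by simp
  have n2: "bubble (us @ y # z # vs) ! length us = max (min c y) z"
    unfolding e1 using l by (metis nth_append_length_plus nth_Cons_0 nth_Cons_Suc add_Suc_right add_0_right)
  \<comment> \<open>The cases say which of \<open>c\<close>, \<open>y\<close>, \<open>z\<close> is
    the largest. If it is \<open>c\<close>, the exchange of \<open>y\<close> and \<open>z\<close>
    does not change the bubble word; otherwise it exchanges two neighbouring letters there.\<close>
  consider "y < c" "z < c" | "c < z" "y < z" | "c < y" "z < y" using ne by force
  then show ?thesis
  proof cases
    case 1
    then have "max c y = c" "max c z = c" "max (min c y) z = max (min c z) y" "max (min c y) z < c"
      by (auto simp: max_def min_def)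
    then show ?thesis unfolding n1 n2 by (simp add: e1 e2)
  next
    case 2
    then have lt: "max c y < max (min c y) z"
      and eq: "max c z = max (min c y) z" "max (min c z) y = max c y"
      using ne by (auto simp: max_def min_def)
    show ?thesis unfolding n1 n2 unfolding e1 e2 eq
      by (simp only: word_inv_swap[OF lt] order_less_not_sym[OF lt] Suc_n_not_le_n)
  next
    case 3
    then have "max (min c y) z < max c y" "max c z = max (min c y) z" "max (min c z) y = max c y"
      using ne by (auto simp: max_def min_def)
    then show ?thesis unfolding n1 n2 unfolding e1 e2
      using word_inv_swap[of "max (min c y) z" "max c y" "bubble us"] by simp
  qed
qed

text \<open>A letter \<open>z\<close> below all of \<open>xs\<close> creates
  \<open>length xs\<close> inversions there, but the minimum appended to \<open>bubble xs\<close> in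
  its place creates only \<open>length xs - 1\<close>: this is the extra 1. Otherwise
  \<open>z\<close> itself is appended on both sides, and the discarded minimum lies below
  \<open>z\<close> and adds nothing.\<close>

lemma word_inv_bubble_snoc:
  assumes "distinct (xs @ [z])" "xs \<noteq> []" "word_inv xs = word_inv (bubble xs) + d"
  shows "word_inv (xs @ [z]) =
    word_inv (bubble (xs @ [z])) + d + (if \<forall>x \<in> set xs. z < x then 1 else 0)"
proof -
  define m where "m = Min (set xs)"
  have m: "m \<in> set xs" "\<And>x. x \<in> set xs \<Longrightarrow> m \<le> x" using assms(2) by (auto simp: m_def)
  have ms: "add_mset m (mset (bubble xs)) = mset xs" using mset_bubble[OF assms(2)] by (simp add: m_def)
  have le: "word_inv (bubble (xs @ [z])) =
      word_inv (bubble xs) + length (filter (\<lambda>y. max m z < y) (bubble xs))"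
    by (simp add: bubble_snoc[OF assms(2)] word_inv_snoc m_def)
  have cnt: "length (filter P (m # bubble xs)) = length (filter P xs)" for P
    using ms by (intro length_filter_mset_cong) simp
  have "m \<noteq> z" using m assms(1) by auto
  show ?thesis
  proof (cases "z < m")
    case True
    have "distinct (m # bubble xs)"
      using ms assms(1) mset_eq_imp_distinct_iff[of "m # bubble xs" xs] by simp
    then have "filter (\<lambda>y. m < y) (bubble xs) = bubble xs"
      using m(2) set_bubble_subset[of xs] by (intro filter_True) (auto simp: order_less_le)
    moreover have all: "\<forall>x \<in> set xs. z < x" using True m(2) by (blast intro: order_less_le_trans)
    moreover have "filter (\<lambda>y. z < y) xs = xs" using all by (intro filter_True)
    moreover have "length xs = Suc (length (bubble xs))" using ms by (metis size_add_mset size_mset)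
    moreover have "max m z = m" using True by simp
    ultimately show ?thesis using le assms(3) unfolding word_inv_snoc by simp
  next
    case False
    then have "m < z" using \<open>m \<noteq> z\<close> by simp
    moreover have "\<not> (\<forall>x \<in> set xs. z < x)" using False m(1) by blast
    moreover have "max m z = z" "\<not> z < m" using \<open>m < z\<close> by auto
    ultimately show ?thesis using le assms(3) cnt[of "\<lambda>y. z < y"]
      by (simp only: word_inv_snoc filter.simps if_False)
  qed
qed

section \<open>Insertion of a largest letter and left-to-right minima\<close>

definition insert_at :: "nat \<Rightarrow> 'a \<Rightarrow> 'a list \<Rightarrow> 'a list" where
  "insert_at k x xs = take k xs @ x # drop k xs"

lemma insert_at_simps [simp]:
  "insert_at 0 x xs = x # xs"
  "insert_at (Suc k) x (y # ys) = y # insert_at k x ys"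
  by (simp_all add: insert_at_def)

text \<open>A letter above all others is emitted at its first comparison. The truncated subtraction
  matters: positions 0 and 1 both give 0, which is the identification made by
  \<open>f\<close>.\<close>

lemma bubble_insert_at:
  assumes "\<And>x. x \<in> set xs \<Longrightarrow> x < M" "k \<le> length xs" "xs \<noteq> []"
  shows "bubble (insert_at k M xs) = insert_at (k - 1) M (bubble xs)"
  using assms
proof (induction xs arbitrary: k rule: bubble.induct)
  case (1 x y zs)
  then have lt: "x < M" "y < M" by auto
  consider "k = 0" | "k = 1" | j where "k = Suc (Suc j)" by (metis One_nat_def not0_implies_Suc)
  then show ?case
  proof cases
    case 3
    have "z < M" if "z \<in> set (min x y # zs)" for z
      using that 1(2) lt by (auto simp: min_def split: if_splits)
    then have "bubble (insert_at (Suc j) M (min x y # zs)) = insert_at j M (bubble (min x y # zs))"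
      using 1(1)[of "Suc j"] 1(3) 3 by simp
    then show ?thesis using 3 by (cases j) simp_all
  qed (use lt in \<open>auto simp: max_def min_def\<close>)
next
  case ("2_2" v)
  then consider "k = 0" | "k = 1" by force
  then show ?case using "2_2" by cases (auto simp: max_def insert_at_def)
qed auto

text \<open>Values instead of positions are collected, so that the set can be compared for two
  rearrangements of the same letters and read off from a canonical presentation.\<close>

fun lr_minima :: "'a::linorder list \<Rightarrow> 'a set" where
  "lr_minima [] = {}"
| "lr_minima (x # xs) = insert x {y \<in> lr_minima xs. y < x}"

lemma lr_minima_subset: "lr_minima xs \<subseteq> set xs"
  by (induction xs) auto

text \<open>A letter that is at least \<open>x\<close> never prevents a letter below
  \<open>x\<close> from being a left-to-right minimum.\<close>

lemma lr_minima_filter: "lr_minima (filter (\<lambda>y. y < x) zs) = {y \<in> lr_minima zs. y < x}"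
proof (induction zs)
  case (Cons z zs)
  have "insert z {y \<in> {y \<in> A. y < x}. y < z} = {y \<in> insert z {y \<in> A. y < z}. y < x}"
    if "z < x" for A using that by (blast intro: order_less_trans)
  moreover have "{y \<in> A. y < x} = {y \<in> insert z {y \<in> A. y < z}. y < x}"
    if "\<not> z < x" for A using that by (auto simp: not_less)
  ultimately show ?case using Cons by (simp only: filter.simps lr_minima.simps split: if_split) simp
qed simp

lemma lr_minima_insert_at:
  assumes "\<And>x. x \<in> set xs \<Longrightarrow> x < M" "k \<le> length xs" "xs \<noteq> []"
  shows "lr_minima (insert_at k M xs) = (if k = 0 then insert M (lr_minima xs) else lr_minima xs)"
  using assms
proof (induction xs arbitrary: k)
  case (Cons x xs)
  show ?case
  proof (cases k)
    case 0
    then show ?thesis using lr_minima_subset[of "x # xs"] Cons.prems(1) by auto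
  next
    case (Suc j)
    show ?thesis
    proof (cases "xs = []")
      case True
      then show ?thesis using Suc Cons.prems by (auto simp: insert_at_def)
    next
      case False
      have "x < M" using Cons.prems(1) by simp
      then have "\<not> M < x" "M \<noteq> x" by auto
      moreover have "lr_minima (insert_at j M xs) =
          (if j = 0 then insert M (lr_minima xs) else lr_minima xs)"
        using Suc Cons.IH[of j] Cons.prems False by simp
      ultimately show ?thesis using Suc by (auto simp del: insert_at_simps(1))
    qed
  qed
qed simp

text \<open>A descent weighs the number of letters behind its top, as in \<open>rmaj\<close>. In
  this recursive form prepending a letter adds at most one term, which fits Foata's transformation
  after reversal.\<close>

fun rev_maj :: "'a::linorder list \<Rightarrow> nat" where
  "rev_maj (x # y # ys) = (if x > y then Suc (length ys) else 0) + rev_maj (y # ys)"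
| "rev_maj _ = 0"

lemma rev_maj_eq_sum:
  "rev_maj xs = (\<Sum>i \<in> {i \<in> {1..length xs - 1}. xs ! (i - 1) > xs ! i}. length xs - i)"
proof (induction xs rule: rev_maj.induct)
  case (1 x y ys)
  let ?S = "\<lambda>xs. {i \<in> {1..length xs - 1}. xs ! (i - 1) > xs ! i}"
  have "?S (x # y # ys) = (if x > y then {1} else {}) \<union> Suc ` ?S (y # ys)"
  proof (intro equalityI subsetI)
    fix i assume i: "i \<in> ?S (x # y # ys)"
    then obtain j where j: "i = Suc j" by (cases i) auto
    show "i \<in> (if x > y then {1} else {}) \<union> Suc ` ?S (y # ys)"
    proof (cases j)
      case 0
      then show ?thesis using i j by auto
    next
      case (Suc k)
      then have "j \<in> ?S (y # ys)" using i j by auto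
      then show ?thesis using j by blast
    qed
  qed (auto split: if_splits simp: nth_Cons')
  moreover have "(\<Sum>i \<in> (if x > y then {1} else {}) \<union> Suc ` ?S (y # ys). length (x # y # ys) - i)
    = (if x > y then Suc (length ys) else 0) + (\<Sum>i \<in> ?S (y # ys). length (y # ys) - i)"
    by (subst sum.union_disjoint) (auto simp: sum.reindex)
  ultimately show ?case using 1 by simp
qed auto

lemma rev_maj_map_strict_mono_on:
  assumes "strict_mono_on A f" "set xs \<subseteq> A"
  shows "rev_maj (map f xs) = rev_maj xs"
  using assms(2)
  by (induction xs rule: rev_maj.induct) (auto simp: strict_mono_on_less[OF assms(1)])

subsection \<open>Foata's transformation\<close>

text \<open>The cutting predicate is made a parameter, so that the two cases of a Foata step share
  their lemmas.\<close>

definition rotate_blocks :: "('a \<Rightarrow> bool) \<Rightarrow> 'a list \<Rightarrow> 'a list" where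
  "rotate_blocks P r = concat (map last_to_front (cut_after P r))"

lemma foata_step_eq:
  "foata_step r x = rotate_blocks (if last r \<le> x then (\<lambda>y. y \<le> x) else (\<lambda>y. y > x)) r @ [x]"
  by (simp add: foata_step_def rotate_blocks_def)

lemma cut_after_block:
  "\<forall>b \<in> set bs. \<not> P b \<Longrightarrow> P y \<Longrightarrow> cut_after P (bs @ y # rest) = (bs @ [y]) # cut_after P rest"
  by (induction bs) auto

lemma rotate_blocks_Nil: "rotate_blocks P [] = []"
  by (simp add: rotate_blocks_def)

lemma rotate_blocks_block:
  "\<forall>b \<in> set bs. \<not> P b \<Longrightarrow> P y \<Longrightarrow> rotate_blocks P (bs @ y # rest) = y # bs @ rotate_blocks P rest"
  by (simp add: rotate_blocks_def cut_after_block last_to_front_def)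

text \<open>If the last letter satisfies \<open>P\<close>, the word is a sequence of compartments
  \<open>bs @ [y]\<close> in which only \<open>y\<close> satisfies \<open>P\<close>, with nothing
  left over. The induction removes the first compartment.\<close>

lemma block_induct [consumes 1, case_names Nil Block]:
  assumes "r = [] \<or> P (last r)" "Q []"
    and "\<And>bs y rest. \<forall>b \<in> set bs. \<not> P b \<Longrightarrow> P y \<Longrightarrow> rest = [] \<or> P (last rest) \<Longrightarrow> Q rest
      \<Longrightarrow> Q (bs @ y # rest)"
  shows "Q r"
  using assms(1)
proof (induction r rule: length_induct)
  case (1 r)
  show ?case
  proof (cases "r = []")
    case False
    then have "\<exists>x \<in> set r. P x" using 1(2) last_in_set by blast
    then obtain bs y rest where r: "r = bs @ y # rest" "P y" "\<forall>b \<in> set bs. \<not> P b"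
      using split_list_first_prop[of r P] by blast
    then have rest: "rest = [] \<or> P (last rest)" using 1(2) by (auto split: if_splits)
    then have "Q rest" using 1(1)[rule_format, of rest] r(1) by simp
    then show ?thesis using assms(3)[OF r(3,2) rest] r(1) by simp
  qed (simp add: assms(2))
qed

lemma mset_rotate_blocks: "r = [] \<or> P (last r) \<Longrightarrow> mset (rotate_blocks P r) = mset r"
  by (induction r rule: block_induct) (auto simp: rotate_blocks_Nil rotate_blocks_block)

text \<open>Each moved letter satisfies \<open>P\<close> and passes only letters that do not, so the
  order inside either class survives.\<close>

lemma filter_rotate_blocks:
  assumes "r = [] \<or> P (last r)"
  shows "filter P (rotate_blocks P r) = filter P r \<and>
    filter (\<lambda>y. \<not> P y) (rotate_blocks P r) = filter (\<lambda>y. \<not> P y) r"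
  using assms
  by (induction r rule: block_induct) (auto simp: rotate_blocks_Nil rotate_blocks_block)

text \<open>The first compartment now begins with its former last letter. In the proof of
  injectivity this letter reveals which predicate was used.\<close>

lemma hd_rotate_blocks:
  assumes "r = [] \<or> P (last r)" "r \<noteq> []"
  shows "rotate_blocks P r \<noteq> [] \<and> P (hd (rotate_blocks P r))"
  using assms by (induction r rule: block_induct) (auto simp: rotate_blocks_block)

lemma rotate_blocks_append:
  "r = [] \<or> P (last r) \<Longrightarrow> rotate_blocks P (r @ r') = rotate_blocks P r @ rotate_blocks P r'"
  by (induction r rule: block_induct) (auto simp: rotate_blocks_Nil rotate_blocks_block)

text \<open>After rotation the compartments begin with their letter satisfying \<open>P\<close>.
  Read backwards they end with it again, so the same rotation restores them.\<close>

lemma rotate_blocks_inverse: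
  assumes "r = [] \<or> P (last r)"
  shows "rev (rotate_blocks P (rev (rotate_blocks P r))) = r"
  using assms
proof (induction r rule: block_induct)
  case (Block bs y rest)
  let ?c = "rotate_blocks P rest"
  have "rest = [] \<or> ?c \<noteq> [] \<and> P (hd ?c)"
    using Block(3) hd_rotate_blocks by blast
  then have "rev ?c = [] \<or> P (last (rev ?c))" by (auto simp: rotate_blocks_Nil last_rev)
  then have "rotate_blocks P (rev ?c @ rev bs @ y # []) =
      rotate_blocks P (rev ?c) @ y # rev bs @ rotate_blocks P []"
    using Block(1,2) by (subst rotate_blocks_append) (auto simp: rotate_blocks_block)
  then show ?case using Block by (simp add: rotate_blocks_block rotate_blocks_Nil)
qed (simp add: rotate_blocks_Nil)

text \<open>Only pairs between \<open>y\<close> and \<open>bs\<close> change their order; the tail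
  may be rearranged to \<open>C\<close>, but \<open>y\<close> and \<open>bs\<close> see it as a
  multiset. The additive form avoids truncated subtraction.\<close>

lemma word_inv_rev_block:
  assumes "mset C = mset rest"
  shows "word_inv (rev (y # bs @ C)) + length (filter (\<lambda>b. b < y) bs) + word_inv (rev rest) =
    word_inv (rev (bs @ y # rest)) + length (filter (\<lambda>b. y < b) bs) + word_inv (rev C)"
proof -
  have "(\<Sum>x\<leftarrow>rev C. length (filter (\<lambda>z. z < x) (rev bs @ [y])))
      = (\<Sum>x\<leftarrow>rev rest. length (filter (\<lambda>z. z < x) (rev bs @ [y])))"
    using assms by (intro sum_list_map_mset_cong) simp
  also have "\<dots> = (\<Sum>x\<leftarrow>rev rest. length (filter (\<lambda>z. z < x) (y # rev bs)))"
    by (intro arg_cong[where f = sum_list] map_cong length_filter_mset_cong) simp_all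
  finally have "word_inv (rev C @ (rev bs @ [y])) + word_inv (y # rev bs) + word_inv (rev rest) =
      word_inv (rev rest @ (y # rev bs)) + word_inv (rev bs @ [y]) + word_inv (rev C)"
    unfolding word_inv_append[of "rev C"] word_inv_append[of "rev rest"] by simp
  then show ?thesis by (simp add: word_inv_snoc rev_filter[symmetric])
qed

text \<open>Each letter not satisfying \<open>P\<close> is passed once, by the smaller letter that
  closes its compartment, and in the reversed word this creates one inversion.\<close>

lemma word_inv_rev_rotate_blocks_up:
  assumes "r = [] \<or> P (last r)" "\<And>a b. a \<in> set r \<Longrightarrow> b \<in> set r \<Longrightarrow> P a \<Longrightarrow> \<not> P b \<Longrightarrow> a < b"
  shows "word_inv (rev (rotate_blocks P r)) =
    word_inv (rev r) + length (filter (\<lambda>y. \<not> P y) r)"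
  using assms
proof (induction r rule: block_induct)
  case (Block bs y rest)
  have "filter (\<lambda>b. y < b) bs = bs" "filter (\<lambda>b. b < y) bs = []" "filter (\<lambda>b. \<not> P b) bs = bs"
    using Block(1,2,5) by (auto intro!: filter_True filter_False dest: order_less_asym)
  moreover have "word_inv (rev (rotate_blocks P rest)) =
      word_inv (rev rest) + length (filter (\<lambda>y. \<not> P y) rest)"
    using Block(4,5) by simp
  ultimately show ?case
    using word_inv_rev_block[OF mset_rotate_blocks[of rest P, OF Block(3)], of y bs] Block(1,2)
    by (simp only: rotate_blocks_block filter_append length_append filter.simps) simp
qed (simp add: rotate_blocks_Nil)

text \<open>Here the passing letter is the larger one, so every passage destroys an inversion of the
  reversed word.\<close>

lemma word_inv_rev_rotate_blocks_down:
  assumes "r = [] \<or> P (last r)" "\<And>a b. a \<in> set r \<Longrightarrow> b \<in> set r \<Longrightarrow> P a \<Longrightarrow> \<not> P b \<Longrightarrow> b < a"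
  shows "word_inv (rev (rotate_blocks P r)) + length (filter (\<lambda>y. \<not> P y) r) = word_inv (rev r)"
  using assms
proof (induction r rule: block_induct)
  case (Block bs y rest)
  have "filter (\<lambda>b. b < y) bs = bs" "filter (\<lambda>b. y < b) bs = []" "filter (\<lambda>b. \<not> P b) bs = bs"
    using Block(1,2,5) by (auto intro!: filter_True filter_False dest: order_less_asym)
  moreover have "word_inv (rev (rotate_blocks P rest)) + length (filter (\<lambda>y. \<not> P y) rest) =
      word_inv (rev rest)"
    using Block(4,5) by simp
  ultimately show ?case
    using word_inv_rev_block[OF mset_rotate_blocks[of rest P, OF Block(3)], of y bs] Block(1,2)
    by (simp only: rotate_blocks_block filter_append length_append filter.simps) simp
qed (simp add: rotate_blocks_Nil)

section \<open>Injectivity, left-to-right minima and inversions of Foata's transformation\<close>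

lemma foata_snoc: "xs \<noteq> [] \<Longrightarrow> foata (xs @ [x]) = foata_step (foata xs) x"
  by (cases xs) auto

lemma last_foata: "xs \<noteq> [] \<Longrightarrow> last (foata xs) = last xs"
proof (cases xs rule: rev_cases)
  case (snoc ys y)
  then show ?thesis by (cases "ys = []") (auto simp: foata_snoc foata_step_eq)
qed simp

lemma mset_foata_step: "mset (foata_step r x) = add_mset x (mset r)"
  by (cases "r = []")
    (auto simp: foata_step_eq mset_rotate_blocks rotate_blocks_Nil not_le)

lemma mset_foata: "mset (foata xs) = mset xs"
proof (induction xs rule: rev_induct)
  case (snoc x xs)
  then show ?case by (cases "xs = []") (auto simp: foata_snoc mset_foata_step)
qed simp

lemma foata_not_Nil: "xs \<noteq> [] \<Longrightarrow> foata xs \<noteq> []"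
  using mset_foata[of xs] by auto

lemma foata_step_inject:
  assumes "foata_step r x = foata_step r' x'" "r \<noteq> []" "r' \<noteq> []"
  shows "r = r' \<and> x = x'"
proof -
  define P where "P = (if last r \<le> x then (\<lambda>y. y \<le> x) else (\<lambda>y. y > x))"
  define P' where "P' = (if last r' \<le> x then (\<lambda>y. y \<le> x) else (\<lambda>y. y > x))"
  have x: "x = x'" and e: "rotate_blocks P r = rotate_blocks P' r'"
    using assms(1) by (auto simp: foata_step_eq P_def P'_def)
  have l: "r = [] \<or> P (last r)" "r' = [] \<or> P' (last r')" by (auto simp: P_def P'_def)
  \<comment> \<open>The two possible predicates exclude each other, so the common first letter
    decides that both words were cut in the same way.\<close>
  have "P (hd (rotate_blocks P r))" "P' (hd (rotate_blocks P r))"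
    using hd_rotate_blocks[of r P] hd_rotate_blocks[of r' P'] l assms(2,3) e by auto
  then have "P = P'" by (auto simp: P_def P'_def split: if_splits)
  then show ?thesis using rotate_blocks_inverse[of r P, OF l(1)] rotate_blocks_inverse[of r' P', OF l(2)] e x by metis
qed

lemma foata_inject: "foata xs = foata ys \<Longrightarrow> xs = ys"
proof (induction xs arbitrary: ys rule: rev_induct)
  case Nil
  then show ?case using mset_foata[of ys] by auto
next
  case (snoc x xs)
  have len: "length ys = Suc (length xs)"
    using snoc.prems mset_foata by (metis length_append_singleton size_mset)
  then obtain zs z where ys: "ys = zs @ [z]" "length zs = length xs"
    by (cases ys rule: rev_cases) auto
  show ?case
  proof (cases "xs = []")
    case True
    then show ?thesis using ys snoc.prems by simp
  next
    case False
    then have "zs \<noteq> []" using ys by auto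
    then show ?thesis using foata_step_inject[of "foata xs" x "foata zs" z] snoc False ys
      by (auto simp: foata_snoc foata_not_Nil)
  qed
qed

text \<open>After reversal \<open>x\<close> stands first, so only letters below \<open>x\<close> can
  be further minima, and a step keeps the relative order of these.\<close>

lemma lr_minima_rev_foata_step:
  assumes "r \<noteq> []"
  shows "lr_minima (rev (foata_step r x)) = lr_minima (rev (r @ [x]))"
proof -
  define P where "P = (if last r \<le> x then (\<lambda>y. y \<le> x) else (\<lambda>y. y > x))"
  have l: "r = [] \<or> P (last r)" by (auto simp: P_def)
  have imp: "(y < x \<and> y \<le> x) = (y < x)" "(y \<le> x \<and> y < x) = (y < x)" for y by auto
  \<comment> \<open>Depending on the case, the letters up to \<open>x\<close> are those that satisfy
    \<open>P\<close> or those that fail it.\<close>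
  have "filter (\<lambda>y. y \<le> x) (rotate_blocks P r) = filter (\<lambda>y. y \<le> x) r"
    using filter_rotate_blocks[of r P, OF l] by (auto simp: P_def not_less split: if_splits)
  then have "filter (\<lambda>y. y < x) (filter (\<lambda>y. y \<le> x) (rotate_blocks P r)) =
      filter (\<lambda>y. y < x) (filter (\<lambda>y. y \<le> x) r)" by simp
  then have "filter (\<lambda>y. y < x) (rotate_blocks P r) = filter (\<lambda>y. y < x) r"
    by (simp only: filter_filter imp)
  then have "lr_minima (filter (\<lambda>y. y < x) (rev (rotate_blocks P r))) =
      lr_minima (filter (\<lambda>y. y < x) (rev r))"
    by (simp add: rev_filter[symmetric])
  then show ?thesis by (simp add: foata_step_eq P_def[symmetric] lr_minima_filter)
qed

lemma lr_minima_rev_of_foata: "lr_minima (rev (foata xs)) = lr_minima (rev xs)"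
proof (induction xs rule: rev_induct)
  case (snoc x xs)
  show ?case
  proof (cases "xs = []")
    case False
    then show ?thesis using snoc
      by (simp add: foata_snoc lr_minima_rev_foata_step foata_not_Nil)
  qed simp
qed simp

text \<open>Put in front, \<open>x\<close> is inverted with the smaller letters. If
  \<open>last r < x\<close>, the rotation adds one inversion for each larger letter, which makes
  \<open>length r\<close> in total; otherwise it removes one for each smaller letter and the two
  effects cancel.\<close>

lemma word_inv_rev_foata_step:
  assumes "r \<noteq> []" "x \<notin> set r"
  shows "word_inv (rev (foata_step r x)) =
    word_inv (rev r) + (if last r < x then length r else 0)"
proof -
  define P where "P = (if last r \<le> x then (\<lambda>y. y \<le> x) else (\<lambda>y. y > x))"
  have l: "r = [] \<or> P (last r)" by (auto simp: P_def)
  have "length (filter Q (rotate_blocks P r)) = length (filter Q r)" for Q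
    by (intro length_filter_mset_cong mset_rotate_blocks l)
  then have e: "word_inv (rev (foata_step r x)) =
      length (filter (\<lambda>y. y < x) r) + word_inv (rev (rotate_blocks P r))"
    by (simp add: foata_step_eq P_def[symmetric] rev_filter[symmetric])
  have "last r \<noteq> x" using assms last_in_set by blast
  then consider "last r < x" | "x < last r" by force
  then show ?thesis
  proof cases
    case 1
    then have P: "P = (\<lambda>y. y \<le> x)" by (auto simp: P_def)
    have "word_inv (rev (rotate_blocks P r)) = word_inv (rev r) + length (filter (\<lambda>y. \<not> P y) r)"
      using l by (rule word_inv_rev_rotate_blocks_up) (auto simp: P)
    moreover have "filter (\<lambda>y. y < x) r = filter P r"
      using assms(2) by (intro filter_cong) (auto simp: P order_less_le)
    ultimately show ?thesis using e 1 sum_length_filter_compl[of P r] by simp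
  next
    case 2
    then have P: "P = (\<lambda>y. x < y)" by (auto simp: P_def)
    have "word_inv (rev (rotate_blocks P r)) + length (filter (\<lambda>y. \<not> P y) r) = word_inv (rev r)"
      using l by (rule word_inv_rev_rotate_blocks_down) (auto simp: P)
    moreover have "filter (\<lambda>y. y < x) r = filter (\<lambda>y. \<not> P y) r"
      using assms(2) by (intro filter_cong) (auto simp: P order_less_le)
    ultimately show ?thesis using e order_less_not_sym[OF 2] by simp
  qed
qed

text \<open>Foata's theorem in reversed form. The words \<open>foata xs\<close> and
  \<open>xs\<close> end with the same letter, so the increment \<open>length xs\<close> occurs
  exactly when prepending \<open>x\<close> to \<open>rev xs\<close> creates a descent, which has the
  same weight.\<close>

lemma word_inv_rev_of_foata:
  "distinct xs \<Longrightarrow> word_inv (rev (foata xs)) = rev_maj (rev xs)"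
proof (induction xs rule: rev_induct)
  case (snoc x xs)
  show ?case
  proof (cases "xs = []")
    case False
    then obtain y ys where xs: "xs = ys @ [y]" by (cases xs rule: rev_cases) auto
    have "set (foata xs) = set xs" "length (foata xs) = length xs"
      using mset_foata[of xs] by (metis set_mset_mset, metis size_mset)
    moreover have "last (foata xs) = y" using last_foata[OF False] xs by simp
    ultimately have "word_inv (rev (foata (xs @ [x]))) =
        word_inv (rev (foata xs)) + (if y < x then length xs else 0)"
      using word_inv_rev_foata_step[of "foata xs" x] snoc.prems False
      by (simp add: foata_snoc foata_not_Nil)
    then show ?thesis using snoc xs by simp
  qed simp
qed simp

lemma mset_rev_foata: "mset (rev_foata xs) = mset xs"
  by (simp add: rev_foata_def mset_foata)

lemma rev_foata_inject: "rev_foata xs = rev_foata ys \<Longrightarrow> xs = ys"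
  using foata_inject by (fastforce simp: rev_foata_def)

lemma lr_minima_rev_foata: "lr_minima (rev_foata xs) = lr_minima xs"
  using lr_minima_rev_of_foata[of "rev xs"] by (simp add: rev_foata_def)

lemma word_inv_rev_foata: "distinct xs \<Longrightarrow> word_inv (rev_foata xs) = rev_maj xs"
  using word_inv_rev_of_foata[of "rev xs"] by (simp add: rev_foata_def)

subsection \<open>Signed permutations\<close>

lemma gen_s_eq:
  assumes "1 \<le> k" "0 < i"
  shows "gen_s k i = (if i = int k then int k + 1 else if i = int k + 1 then int k else i)"
  using assms by (auto simp: gen_s_def transpose_def)

lemma gen_s_minus: "1 \<le> k \<Longrightarrow> gen_s k (- i) = - gen_s k i"
  by (auto simp: gen_s_def transpose_def)

text \<open>This is \<open>S_m\<close> inside \<open>B_m\<close>. Positivity is stated for all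
  positive integers, those above \<open>m\<close> being fixed, so that products need no range
  conditions.\<close>

definition pos_perms :: "nat \<Rightarrow> (int \<Rightarrow> int) set" where
  "pos_perms m = {\<sigma> \<in> signed_perms m. \<forall>i>0. 0 < \<sigma> i}"

definition alt_perms :: "nat \<Rightarrow> (int \<Rightarrow> int) set" where
  "alt_perms m = {\<sigma> \<in> pos_perms m. evenperm (abs_perm m \<sigma>)}"

lemma signed_permsD:
  assumes "\<sigma> \<in> signed_perms m"
  shows "\<sigma> permutes {- int m..int m} - {0}" "\<sigma> (- i) = - \<sigma> i" "inj \<sigma>" "surj \<sigma>" "\<sigma> 0 = 0"
    "inv \<sigma> \<circ> \<sigma> = id" "\<sigma> \<circ> inv \<sigma> = id" "\<sigma> (inv \<sigma> i) = i" "inv \<sigma> (\<sigma> i) = i"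
proof -
  show p: "\<sigma> permutes {- int m..int m} - {0}" and "\<sigma> (- i) = - \<sigma> i"
    using assms by (auto simp: signed_perms_def)
  show "inj \<sigma>" by (rule permutes_inj[OF p])
  show "surj \<sigma>" by (rule permutes_surj[OF p])
  show "\<sigma> 0 = 0" using p by (auto simp: permutes_def)
  show "inv \<sigma> \<circ> \<sigma> = id" "\<sigma> \<circ> inv \<sigma> = id" using p by (auto simp: permutes_inv_o)
  show "\<sigma> (inv \<sigma> i) = i" "inv \<sigma> (\<sigma> i) = i" using p by (auto simp: permutes_inverses)
qed

lemma signed_perms_fix: "\<sigma> \<in> signed_perms m \<Longrightarrow> int m < i \<Longrightarrow> \<sigma> i = i"
  by (auto simp: signed_perms_def permutes_def)

lemma id_signed_perms: "id \<in> signed_perms m"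
  by (auto simp: signed_perms_def permutes_id)

lemma signed_perms_comp:
  "\<sigma> \<in> signed_perms m \<Longrightarrow> \<tau> \<in> signed_perms m \<Longrightarrow> \<sigma> \<circ> \<tau> \<in> signed_perms m"
  by (auto simp: signed_perms_def intro: permutes_compose)

lemma signed_perms_inv:
  assumes "\<sigma> \<in> signed_perms m" shows "inv \<sigma> \<in> signed_perms m"
proof -
  have "inv \<sigma> (- i) = - inv \<sigma> i" for i
    by (metis assms signed_permsD(2,8,9))
  then show ?thesis using signed_permsD(1)[OF assms] by (auto simp: signed_perms_def permutes_inv)
qed

lemma signed_perms_range:
  assumes "\<sigma> \<in> signed_perms m" "i \<in> {1..int m}"
  shows "\<bar>\<sigma> i\<bar> \<in> {1..int m}"
proof -
  have "\<sigma> i \<in> {- int m..int m} - {0}"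
    using permutes_in_image[OF signed_permsD(1)[OF assms(1)], of i] assms(2) by auto
  then show ?thesis by auto
qed

lemma signed_perms_ext:
  assumes "\<sigma> \<in> signed_perms m" "\<tau> \<in> signed_perms m" "\<And>i. i \<in> {1..int m} \<Longrightarrow> \<sigma> i = \<tau> i"
  shows "\<sigma> = \<tau>"
proof
  fix i :: int
  have pos: "\<sigma> i = \<tau> i" if "0 < i" for i
    using assms(3)[of i] signed_perms_fix[OF assms(1), of i] signed_perms_fix[OF assms(2), of i] that
    by (cases "i \<le> int m") auto
  consider "0 < i" | "i = 0" | "0 < - i" by linarith
  then show "\<sigma> i = \<tau> i"
    by cases (use pos[of i] pos[of "- i"] signed_permsD(2,5)[OF assms(1)] signed_permsD(2,5)[OF assms(2)] in auto)
qed

lemma signed_perms_mono: "m \<le> k \<Longrightarrow> signed_perms m \<subseteq> signed_perms k"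
  by (auto simp: signed_perms_def intro: permutes_subset)

lemma signed_perms_drop:
  assumes "\<sigma> \<in> signed_perms (Suc m)" "\<sigma> (int (Suc m)) = int (Suc m)"
  shows "\<sigma> \<in> signed_perms m"
proof -
  have "\<sigma> permutes {- int m..int m} - {0}"
  proof (rule permutes_superset[OF signed_permsD(1)[OF assms(1)]])
    fix x assume "x \<in> {- int (Suc m)..int (Suc m)} - {0} - ({- int m..int m} - {0})"
    then have "x = int (Suc m) \<or> x = - int (Suc m)" by auto
    then show "\<sigma> x = x" using assms(2) signed_permsD(2)[OF assms(1)] by metis
  qed
  then show ?thesis using signed_permsD(2)[OF assms(1)] by (auto simp: signed_perms_def)
qed

lemma pos_perms_signed: "\<sigma> \<in> pos_perms m \<Longrightarrow> \<sigma> \<in> signed_perms m"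
  by (simp add: pos_perms_def)

lemma id_pos_perms: "id \<in> pos_perms m"
  by (simp add: pos_perms_def id_signed_perms)

lemma pos_perms_comp:
  "\<sigma> \<in> pos_perms m \<Longrightarrow> \<tau> \<in> pos_perms m \<Longrightarrow> \<sigma> \<circ> \<tau> \<in> pos_perms m"
  by (auto simp: pos_perms_def signed_perms_comp)

lemma pos_perms_inv:
  assumes "\<sigma> \<in> pos_perms m" shows "inv \<sigma> \<in> pos_perms m"
proof -
  note S = pos_perms_signed[OF assms]
  have "0 < inv \<sigma> i" if "0 < i" for i
  proof (rule ccontr)
    assume "\<not> 0 < inv \<sigma> i"
    then have "inv \<sigma> i = 0 \<or> 0 < - inv \<sigma> i" by linarith
    moreover have "\<sigma> (- inv \<sigma> i) = - i" using signed_permsD(2,8)[OF S] by simp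
    moreover have "0 < - inv \<sigma> i \<Longrightarrow> 0 < \<sigma> (- inv \<sigma> i)"
      using assms unfolding pos_perms_def by blast
    ultimately show False using that signed_permsD(5)[OF S] by auto
  qed
  then show ?thesis by (auto simp: pos_perms_def signed_perms_inv S)
qed

lemma pos_perms_mono: "m \<le> k \<Longrightarrow> pos_perms m \<subseteq> pos_perms k"
  using signed_perms_mono by (auto simp: pos_perms_def)

lemma pos_perms_drop:
  "\<sigma> \<in> pos_perms (Suc m) \<Longrightarrow> \<sigma> (int (Suc m)) = int (Suc m) \<Longrightarrow> \<sigma> \<in> pos_perms m"
  using signed_perms_drop by (auto simp: pos_perms_def)

lemma pos_perms_range:
  assumes "\<sigma> \<in> pos_perms m" "i \<in> {1..int m}" shows "\<sigma> i \<in> {1..int m}"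
proof -
  have "0 < \<sigma> i" using assms by (auto simp: pos_perms_def)
  then show ?thesis using signed_perms_range[OF pos_perms_signed[OF assms(1)] assms(2)] by auto
qed

lemma pos_perms_image:
  assumes "\<sigma> \<in> pos_perms m" shows "\<sigma> ` {1..int m} = {1..int m}"
proof (rule card_subset_eq)
  show "card (\<sigma> ` {1..int m}) = card {1..int m}"
    by (intro card_image inj_on_subset[OF signed_permsD(3)[OF pos_perms_signed[OF assms]]]) auto
qed (use pos_perms_range[OF assms] in auto)

lemma gen_s_pos_perms: assumes "1 \<le> k" "k < m" shows "gen_s k \<in> pos_perms m"
proof -
  have "gen_s k permutes {- int m..int m} - {0}"
    unfolding gen_s_def using assms
    by (intro permutes_compose permutes_swap_id) auto
  then show ?thesis using assms gen_s_minus gen_s_eq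
    by (auto simp: pos_perms_def signed_perms_def)
qed

lemma gen_s_gen_s: assumes "1 \<le> k" shows "gen_s k \<circ> gen_s k = id"
proof (rule signed_perms_ext[of _ "Suc k"])
  have "gen_s k \<in> signed_perms (Suc k)" using gen_s_pos_perms[of k "Suc k"] assms
    by (auto intro: pos_perms_signed)
  then show "gen_s k \<circ> gen_s k \<in> signed_perms (Suc k)" by (intro signed_perms_comp)
qed (use assms in \<open>auto simp: id_signed_perms gen_s_eq\<close>)

section \<open>Parity of the underlying unsigned permutation\<close>

lemma abs_perm_permutes:
  assumes "\<sigma> \<in> signed_perms m" shows "abs_perm m \<sigma> permutes {1..int m}"
proof (rule bij_imp_permutes)
  have inj: "inj_on (abs_perm m \<sigma>) {1..int m}"
  proof (rule inj_onI)
    fix x y assume xy: "x \<in> {1..int m}" "y \<in> {1..int m}" "abs_perm m \<sigma> x = abs_perm m \<sigma> y"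
    then have "\<sigma> x = \<sigma> y \<or> \<sigma> x = \<sigma> (- y)"
      using signed_permsD(2)[OF assms, of y] by (auto simp: abs_perm_def abs_eq_iff)
    then have "x = y \<or> x = - y" using signed_permsD(3)[OF assms] by (auto dest: injD)
    then show "x = y" using xy by auto
  qed
  moreover have "abs_perm m \<sigma> ` {1..int m} \<subseteq> {1..int m}"
    using signed_perms_range[OF assms] by (force simp: abs_perm_def)
  ultimately show "bij_betw (abs_perm m \<sigma>) {1..int m} {1..int m}"
    by (simp add: bij_betw_def endo_inj_surj)
qed (auto simp: abs_perm_def)

lemma abs_perm_permutation: "\<sigma> \<in> signed_perms m \<Longrightarrow> permutation (abs_perm m \<sigma>)"
  using abs_perm_permutes permutation_permutes by blast

text \<open>Since \<open>\<sigma>\<close> is an odd function, the absolute value of its result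
  depends only on that of its argument. Hence forgetting signs is a homomorphism, and parity can be
  computed factor by factor.\<close>

lemma abs_perm_comp:
  assumes "\<sigma> \<in> signed_perms m" "\<tau> \<in> signed_perms m"
  shows "abs_perm m (\<sigma> \<circ> \<tau>) = abs_perm m \<sigma> \<circ> abs_perm m \<tau>"
proof
  fix i
  have "\<bar>\<sigma> \<bar>x\<bar>\<bar> = \<bar>\<sigma> x\<bar>" for x
    using signed_permsD(2)[OF assms(1), of x] by (cases "0 \<le> x") auto
  then show "abs_perm m (\<sigma> \<circ> \<tau>) i = (abs_perm m \<sigma> \<circ> abs_perm m \<tau>) i"
    using signed_perms_range[OF assms(2), of i] by (auto simp: abs_perm_def)
qed

lemma evenperm_abs_perm_comp:
  assumes "\<sigma> \<in> signed_perms m" "\<tau> \<in> signed_perms m"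
  shows "evenperm (abs_perm m (\<sigma> \<circ> \<tau>)) \<longleftrightarrow> (evenperm (abs_perm m \<sigma>) \<longleftrightarrow> evenperm (abs_perm m \<tau>))"
  using assms by (simp add: abs_perm_comp evenperm_comp abs_perm_permutation)

lemma abs_perm_id: "abs_perm m id = id"
  by (auto simp: abs_perm_def)

lemma evenperm_abs_perm_inv:
  assumes "\<sigma> \<in> signed_perms m"
  shows "evenperm (abs_perm m (inv \<sigma>)) \<longleftrightarrow> evenperm (abs_perm m \<sigma>)"
  using evenperm_abs_perm_comp[OF assms signed_perms_inv[OF assms]]
  by (simp add: signed_permsD(7)[OF assms] abs_perm_id)

lemma abs_perm_mono:
  assumes "\<sigma> \<in> signed_perms m" "m \<le> k" shows "abs_perm k \<sigma> = abs_perm m \<sigma>"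
  using assms signed_perms_fix[OF assms(1)] by (force simp: abs_perm_def)

lemma not_evenperm_gen_s:
  assumes "1 \<le> k" "k < m" shows "\<not> evenperm (abs_perm m (gen_s k))"
proof -
  have "abs_perm m (gen_s k) = transpose (int k) (int k + 1)"
    using assms by (auto simp: abs_perm_def gen_s_eq transpose_def fun_eq_iff)
  then show ?thesis by (simp add: evenperm_swap)
qed

lemma alt_perms_comp:
  "\<sigma> \<in> alt_perms m \<Longrightarrow> \<tau> \<in> alt_perms m \<Longrightarrow> \<sigma> \<circ> \<tau> \<in> alt_perms m"
  by (auto simp: alt_perms_def pos_perms_comp evenperm_abs_perm_comp pos_perms_signed)

lemma alt_perms_inv: "\<sigma> \<in> alt_perms m \<Longrightarrow> inv \<sigma> \<in> alt_perms m"
  by (auto simp: alt_perms_def pos_perms_inv evenperm_abs_perm_inv pos_perms_signed)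

lemma alt_perms_mono: "m \<le> k \<Longrightarrow> alt_perms m \<subseteq> alt_perms k"
  using pos_perms_mono abs_perm_mono[OF pos_perms_signed, of _ m k] by (auto simp: alt_perms_def)

lemma alt_perms_drop:
  assumes "\<sigma> \<in> alt_perms (Suc m)" "\<sigma> (int (Suc m)) = int (Suc m)"
  shows "\<sigma> \<in> alt_perms m"
proof -
  have "\<sigma> \<in> pos_perms m" using pos_perms_drop assms by (auto simp: alt_perms_def)
  then show ?thesis using assms abs_perm_mono[OF pos_perms_signed, of \<sigma> m "Suc m"]
    by (auto simp: alt_perms_def)
qed

section \<open>Descending products of generators as cycles\<close>

lemma group_prod_Nil: "group_prod [] = id"
  by (simp add: group_prod_def)

lemma group_prod_Cons: "group_prod (x # xs) = x \<circ> group_prod xs"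
  by (simp add: group_prod_def)

lemma group_prod_append: "group_prod (xs @ ys) = group_prod xs \<circ> group_prod ys"
  by (induction xs) (auto simp: group_prod_Nil group_prod_Cons)

lemma s_desc_trivial: "s_desc j (Suc j) = id"
  by (simp add: s_desc_def group_prod_Nil)

lemma s_desc_Suc: "l \<le> Suc j \<Longrightarrow> s_desc (Suc j) l = gen_s (Suc j) \<circ> s_desc j l"
  by (simp add: s_desc_def group_prod_Cons)

lemma a_desc_trivial: "a_desc j (Suc j) = id"
  by (simp add: a_desc_def group_prod_Nil)

lemma a_desc_Suc: "l \<le> Suc j \<Longrightarrow> a_desc (Suc j) l = gen_a (Suc j) \<circ> a_desc j l"
  by (simp add: a_desc_def group_prod_Cons)

lemma s_desc_apply:
  assumes "1 \<le> l" "l \<le> Suc j" "0 < i"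
  shows "s_desc j l i = (if i = int l then int j + 1
           else if int l < i \<and> i \<le> int j + 1 then i - 1 else i)"
  using assms(2)
proof (induction j)
  case 0
  then have "l = Suc 0" using assms(1) by simp
  then show ?case by (simp add: s_desc_trivial)
next
  case (Suc j)
  show ?case
  proof (cases "l = Suc (Suc j)")
    case True
    then show ?thesis by (simp add: s_desc_trivial)
  next
    case False
    then have l: "l \<le> Suc j" using Suc.prems by simp
    have "0 < s_desc j l i" using Suc.IH[OF l] assms(1,3) by (auto split: if_splits)
    then have "s_desc (Suc j) l i = (if s_desc j l i = int j + 1 then int j + 2
        else if s_desc j l i = int j + 2 then int j + 1 else s_desc j l i)"
      using gen_s_eq[of "Suc j" "s_desc j l i"] by (simp add: s_desc_Suc[OF l])
    then show ?thesis using l unfolding Suc.IH[OF l] by auto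
  qed
qed

lemma s_desc_pos_perms:
  assumes "1 \<le> l" "l \<le> Suc j" shows "s_desc j l \<in> pos_perms (Suc j)"
  using assms(2)
proof (induction j)
  case 0
  then have "l = Suc 0" using assms(1) by simp
  then show ?case using s_desc_trivial[of 0] id_pos_perms[of "Suc 0"] by metis
next
  case (Suc j)
  show ?case
  proof (cases "l = Suc (Suc j)")
    case True
    then show ?thesis using s_desc_trivial[of "Suc j"] id_pos_perms by metis
  next
    case False
    then have l: "l \<le> Suc j" using Suc.prems by simp
    show ?thesis unfolding s_desc_Suc[OF l]
      using Suc.IH[OF l] pos_perms_mono[of "Suc j" "Suc (Suc j)"]
      by (intro pos_perms_comp gen_s_pos_perms) auto
  qed
qed

lemma evenperm_s_desc:
  assumes "1 \<le> l" "l \<le> Suc j"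
  shows "evenperm (abs_perm (Suc j) (s_desc j l)) \<longleftrightarrow> even (Suc j - l)"
  using assms(2)
proof (induction j)
  case 0
  then have "l = Suc 0" using assms(1) by simp
  then show ?case using s_desc_trivial[of 0] abs_perm_id[of "Suc 0"]
    by (metis diff_self_eq_0 even_zero evenperm_id)
next
  case (Suc j)
  show ?case
  proof (cases "l = Suc (Suc j)")
    case True
    then show ?thesis using s_desc_trivial[of "Suc j"] abs_perm_id[of "Suc (Suc j)"]
      by (metis diff_self_eq_0 even_zero evenperm_id)
  next
    case False
    then have l: "l \<le> Suc j" using Suc.prems by simp
    note s = pos_perms_signed[OF s_desc_pos_perms[OF assms(1) l]]
    have "gen_s (Suc j) \<in> signed_perms (Suc (Suc j))"
      by (intro pos_perms_signed gen_s_pos_perms) auto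
    moreover have "s_desc j l \<in> signed_perms (Suc (Suc j))"
      using s signed_perms_mono[of "Suc j" "Suc (Suc j)"] by auto
    ultimately have "evenperm (abs_perm (Suc (Suc j)) (s_desc (Suc j) l)) \<longleftrightarrow>
        \<not> evenperm (abs_perm (Suc j) (s_desc j l))"
      unfolding s_desc_Suc[OF l]
      using evenperm_abs_perm_comp not_evenperm_gen_s[of "Suc j" "Suc (Suc j)"]
        abs_perm_mono[OF s, of "Suc (Suc j)"] by simp
    then show ?thesis using Suc.IH[OF l] l by (simp add: Suc_diff_le)
  qed
qed

subsection \<open>Canonical presentations\<close>

text \<open>\<open>a_factor j p\<close> is the element of \<open>R\<^sub>j\<^sup>A\<close> that carries \<open>p\<close> to \<open>j + 2\<close>: for \<open>p \<ge> 2\<close> it is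
  \<open>a\<^sub>j \<dots> a\<^sub>p\<^sub>-\<^sub>1\<close>, and for \<open>p = 1\<close> it is \<open>a\<^sub>j \<dots> a\<^sub>2 a\<^sub>1\<^sup>-\<^sup>1\<close>. Since \<open>s\<^sub>1\<close> commutes with \<open>s\<^sub>3, s\<^sub>4, \<dots>\<close>, its
  powers collect on the left, and their parity is forced by evenness.\<close>

definition a_factor :: "nat \<Rightarrow> nat \<Rightarrow> int \<Rightarrow> int" where
  "a_factor j p = (if even (j + p) then id else gen_s 1) \<circ> s_desc (Suc j) p"

lemma gen_s_commute: assumes "3 \<le> k" shows "gen_s k \<circ> gen_s 1 = gen_s 1 \<circ> gen_s k"
proof (rule signed_perms_ext[of _ "Suc k"])
  have "gen_s k \<in> signed_perms (Suc k)" "gen_s 1 \<in> signed_perms (Suc k)"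
    using gen_s_pos_perms[of k "Suc k"] gen_s_pos_perms[of 1 "Suc k"] assms
    by (auto intro: pos_perms_signed)
  then show "gen_s k \<circ> gen_s 1 \<in> signed_perms (Suc k)" "gen_s 1 \<circ> gen_s k \<in> signed_perms (Suc k)"
    by (auto intro: signed_perms_comp)
qed (use assms in \<open>auto simp: gen_s_eq\<close>)

lemma a_desc_eq_a_factor:
  assumes "1 \<le> l" "l \<le> Suc j" shows "a_desc j l = a_factor j (Suc l)"
  using assms(2)
proof (induction j)
  case 0
  then have "l = Suc 0" using assms(1) by simp
  then show ?case using a_desc_trivial[of 0] s_desc_trivial[of 1] by (simp add: a_factor_def)
next
  case (Suc j)
  show ?case
  proof (cases "l = Suc (Suc j)")
    case True
    then show ?thesis using a_desc_trivial[of "Suc j"] s_desc_trivial[of "Suc (Suc j)"]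
      by (simp add: a_factor_def)
  next
    case False
    then have l: "l \<le> Suc j" using Suc.prems by simp
    let ?e = "\<lambda>j. if even (j + Suc l) then id else gen_s 1"
    have e: "gen_s 1 \<circ> gen_s (Suc (Suc j)) \<circ> ?e j = ?e (Suc j) \<circ> gen_s (Suc (Suc j))"
    proof (cases "even (j + Suc l)")
      case False
      \<comment> \<open>For \<open>j = 0\<close> the bounds force \<open>l = 1\<close> and an even
        sum. Hence the generator to be crossed has index at least 3 and commutes with
        \<open>s_1\<close>.\<close>
      then have "j \<noteq> 0" using l assms(1) by (cases "j = 0") auto
      then have "gen_s 1 \<circ> gen_s (Suc (Suc j)) \<circ> gen_s 1 = gen_s 1 \<circ> gen_s 1 \<circ> gen_s (Suc (Suc j))"
        using gen_s_commute[of "Suc (Suc j)"] by (simp only: comp_assoc)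
      then show ?thesis using False gen_s_gen_s[of 1] by simp
    qed simp
    have "a_desc (Suc j) l = gen_s 1 \<circ> gen_s (Suc (Suc j)) \<circ> ?e j \<circ> s_desc (Suc j) (Suc l)"
      using Suc.IH[OF l] by (simp add: a_desc_Suc[OF l] gen_a_def a_factor_def comp_assoc del: comp_apply)
    also have "\<dots> = a_factor (Suc j) (Suc l)"
      unfolding e using l by (simp add: a_factor_def s_desc_Suc comp_assoc)
    finally show ?thesis .
  qed
qed

lemma s_desc_right: "l \<le> j \<Longrightarrow> s_desc j (Suc l) \<circ> gen_s l = s_desc j l"
  by (simp add: s_desc_def upt_conv_Cons[of l] group_prod_append group_prod_Cons group_prod_Nil
      del: upt_Suc)

text \<open>As \<open>a_1\<close> is \<open>s_1 s_2\<close>, its inverse \<open>s_2 s_1\<close>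
  continues the descending run of \<open>a_desc j 2\<close> down to \<open>s_1\<close>. The power of
  \<open>s_1\<close> on the left is unchanged, since \<open>j + 3\<close> and \<open>j + 1\<close>
  have the same parity.\<close>

lemma a_desc_inv_eq_a_factor: assumes "1 \<le> j" shows "a_desc_inv j = a_factor j 1"
proof -
  have "gen_s 1 \<circ> gen_s 2 \<circ> (gen_s 2 \<circ> gen_s 1) = gen_s 1 \<circ> (gen_s 2 \<circ> gen_s 2) \<circ> gen_s 1"
    by (simp only: comp_assoc)
  then have 1: "gen_a 1 \<circ> (gen_s 2 \<circ> gen_s 1) = id"
    by (simp add: gen_a_def gen_s_gen_s numeral_2_eq_2)
  have "gen_s 2 \<circ> gen_s 1 \<circ> (gen_s 1 \<circ> gen_s 2) = gen_s 2 \<circ> (gen_s 1 \<circ> gen_s 1) \<circ> gen_s 2"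
    by (simp only: comp_assoc)
  then have 2: "(gen_s 2 \<circ> gen_s 1) \<circ> gen_a 1 = id"
    by (simp add: gen_a_def gen_s_gen_s numeral_2_eq_2)
  have "inv (gen_a 1) = gen_s 2 \<circ> gen_s 1" using inv_unique_comp[OF 1 2] .
  then have "a_desc_inv j = a_factor j 3 \<circ> gen_s 2 \<circ> gen_s 1"
    using a_desc_eq_a_factor[of 2 j] assms
    by (simp add: a_desc_inv_def comp_assoc numeral_3_eq_3 numeral_2_eq_2)
  also have "\<dots> = (if even (j + 3) then id else gen_s 1) \<circ> (s_desc (Suc j) (Suc 2) \<circ> gen_s 2 \<circ> gen_s 1)"
    by (simp add: a_factor_def comp_assoc numeral_3_eq_3 numeral_2_eq_2)
  also have "s_desc (Suc j) (Suc 2) \<circ> gen_s 2 \<circ> gen_s 1 = s_desc (Suc j) 1"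
    using s_desc_right[of 2 "Suc j"] s_desc_right[of 1 "Suc j"] assms by (simp add: numeral_2_eq_2)
  finally show ?thesis by (simp add: a_factor_def del: comp_apply)
qed

lemma a_factor_alt_perms:
  assumes "1 \<le> p" "p \<le> Suc (Suc j)" shows "a_factor j p \<in> alt_perms (Suc (Suc j))"
proof -
  note s = s_desc_pos_perms[OF assms]
  have g: "gen_s 1 \<in> pos_perms (Suc (Suc j))" by (rule gen_s_pos_perms) auto
  have "even (Suc (Suc j) - p) \<longleftrightarrow> even (j + p)" using assms by auto
  then have "evenperm (abs_perm (Suc (Suc j)) (s_desc (Suc j) p)) \<longleftrightarrow> even (j + p)"
    using evenperm_s_desc[OF assms] by simp
  then show ?thesis
    using s g pos_perms_comp[OF g s] not_evenperm_gen_s[of 1 "Suc (Suc j)"]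
      evenperm_abs_perm_comp[OF pos_perms_signed[OF g] pos_perms_signed[OF s]]
    by (simp add: alt_perms_def a_factor_def)
qed

lemma a_factor_apply:
  assumes "1 \<le> p" "p \<le> Suc (Suc j)" "1 \<le> j"
  shows "a_factor j p (int p) = int (Suc (Suc j))"
  using assms by (simp add: a_factor_def s_desc_apply gen_s_eq)

text \<open>Both canonical presentations arise in the same way: the position of the largest value
  determines the last factor, and dividing it off leaves an element of the next smaller group.\<close>

locale factor_tower =
  fixes G :: "nat \<Rightarrow> (int \<Rightarrow> int) set" and r :: "nat \<Rightarrow> nat \<Rightarrow> int \<Rightarrow> int" and d :: nat
  assumes G_0: "G 0 = {id}"
    and G_pos: "G j \<subseteq> pos_perms (j + d)"
    and G_comp: "g \<in> G j \<Longrightarrow> h \<in> G j \<Longrightarrow> g \<circ> h \<in> G j"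
    and G_inv: "g \<in> G j \<Longrightarrow> inv g \<in> G j"
    and G_Suc: "G j \<subseteq> G (Suc j)"
    and G_drop: "g \<in> G (Suc j) \<Longrightarrow> g (int (Suc j + d)) = int (Suc j + d) \<Longrightarrow> g \<in> G j"
    and r_G: "1 \<le> p \<Longrightarrow> p \<le> Suc j + d \<Longrightarrow> r (Suc j) p \<in> G (Suc j)"
    and r_top: "1 \<le> p \<Longrightarrow> p \<le> Suc j + d \<Longrightarrow> r (Suc j) p (int p) = int (Suc j + d)"
begin

text \<open>A code chooses one of the \<open>j + d\<close> factors for each \<open>j\<close>, in the
  manner of a Lehmer code. The offset \<open>d\<close> will be 1 for the symmetric and 2 for the
  alternating groups.\<close>

definition valid :: "nat \<Rightarrow> (nat \<Rightarrow> nat) \<Rightarrow> bool" where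
  "valid k c \<longleftrightarrow> (\<forall>j \<in> {1..k}. 1 \<le> c j \<and> c j \<le> j + d)"

definition code_prod :: "nat \<Rightarrow> (nat \<Rightarrow> nat) \<Rightarrow> int \<Rightarrow> int" where
  "code_prod k c = group_prod (map (\<lambda>j. r j (c j)) [1..<Suc k])"

lemma code_prod_0: "code_prod 0 c = id"
  by (simp add: code_prod_def group_prod_Nil)

lemma code_prod_Suc: "code_prod (Suc k) c = code_prod k c \<circ> r (Suc k) (c (Suc k))"
  by (simp add: code_prod_def group_prod_append group_prod_Cons group_prod_Nil)

lemma valid_Suc: "valid (Suc k) c \<longleftrightarrow> valid k c \<and> 1 \<le> c (Suc k) \<and> c (Suc k) \<le> Suc k + d"
proof -
  have "{1..Suc k} = insert (Suc k) {1..k}" by auto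
  then show ?thesis by (auto simp: valid_def)
qed

lemma valid_cong: "(\<And>j. j \<in> {1..k} \<Longrightarrow> c j = c' j) \<Longrightarrow> valid k c \<longleftrightarrow> valid k c'"
  by (auto simp: valid_def)

lemma code_prod_cong: "(\<And>j. j \<in> {1..k} \<Longrightarrow> c j = c' j) \<Longrightarrow> code_prod k c = code_prod k c'"
  unfolding code_prod_def by (intro arg_cong[where f = group_prod] map_cong) auto

lemma code_prod_G: "valid k c \<Longrightarrow> code_prod k c \<in> G k"
proof (induction k)
  case (Suc k)
  then show ?case using G_Suc[of k] unfolding code_prod_Suc valid_Suc
    by (intro G_comp r_G) auto
qed (simp add: code_prod_0 G_0)

lemma r_inj: "1 \<le> p \<Longrightarrow> p \<le> Suc j + d \<Longrightarrow> 1 \<le> q \<Longrightarrow> q \<le> Suc j + d \<Longrightarrow>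
    r (Suc j) p = r (Suc j) q \<Longrightarrow> p = q"
  using signed_permsD(3)[OF pos_perms_signed[OF subsetD[OF G_pos r_G]], of p j]
    r_top[of p j] r_top[of q j] by (metis injD of_nat_eq_iff)

lemma code_exists: "g \<in> G k \<Longrightarrow> \<exists>c. valid k c \<and> code_prod k c = g"
proof (induction k arbitrary: g)
  case 0
  then show ?case by (auto simp: valid_def code_prod_0 G_0)
next
  case (Suc k)
  let ?T = "Suc k + d"
  have g: "g \<in> pos_perms ?T" using Suc.prems G_pos by blast
  have "int ?T \<in> g ` {1..int ?T}" using pos_perms_image[OF g] by auto
  then obtain i where i: "i \<in> {1..int ?T}" "g i = int ?T" by force
  define p where "p = nat i"
  have p: "1 \<le> p" "p \<le> ?T" "g (int p) = int ?T" using i by (auto simp: p_def)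
  define q where "q = r (Suc k) p"
  have q: "q \<in> G (Suc k)" "q (int p) = int ?T" using r_G[OF p(1,2)] r_top[OF p(1,2)] by (auto simp: q_def)
  have qs: "q \<in> signed_perms ?T" using q(1) G_pos pos_perms_signed by blast
  have "inv q (int ?T) = int p" using signed_permsD(9)[OF qs, of "int p"] q(2) by simp
  then have "(g \<circ> inv q) (int ?T) = int ?T" using p(3) by simp
  then have "g \<circ> inv q \<in> G k" by (rule G_drop[OF G_comp[OF Suc.prems G_inv[OF q(1)]]])
  then obtain c where c: "valid k c" "code_prod k c = g \<circ> inv q" using Suc.IH by blast
  have "code_prod (Suc k) (c(Suc k := p)) = g \<circ> inv q \<circ> q"
    using c(2) code_prod_cong[of k "c(Suc k := p)" c] by (simp add: code_prod_Suc q_def)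
  also have "\<dots> = g" by (simp only: comp_assoc signed_permsD(6)[OF qs] comp_id)
  finally have "code_prod (Suc k) (c(Suc k := p)) = g" .
  moreover have "valid (Suc k) (c(Suc k := p))"
    using c(1) p valid_cong[of k "c(Suc k := p)" c] by (simp add: valid_Suc)
  ultimately show ?case by blast
qed

text \<open>The earlier factors fix the top value, so its position in the product is the last entry
  of the code. Cancelling the last factor leaves the rest to the induction hypothesis.\<close>

lemma code_unique:
  "valid k c \<Longrightarrow> valid k c' \<Longrightarrow> code_prod k c = code_prod k c' \<Longrightarrow> j \<in> {1..k} \<Longrightarrow> c j = c' j"
proof (induction k)
  case (Suc k)
  let ?T = "Suc k + d" and ?p = "c (Suc k)" and ?p' = "c' (Suc k)"
  have v: "valid k c" "1 \<le> ?p" "?p \<le> ?T" "valid k c'" "1 \<le> ?p'" "?p' \<le> ?T"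
    using Suc.prems(1,2) by (auto simp: valid_Suc)
  have fix_top: "code_prod k b (int ?T) = int ?T" if "valid k b" for b
    using signed_perms_fix[OF pos_perms_signed[OF subsetD[OF G_pos code_prod_G[OF that]]], of "int ?T"]
    by simp
  have eq: "code_prod k c \<circ> r (Suc k) ?p = code_prod k c' \<circ> r (Suc k) ?p'"
    using Suc.prems(3) unfolding code_prod_Suc .
  have "(code_prod k c \<circ> r (Suc k) ?p) (int ?p) = int ?T"
    using r_top[OF v(2,3)] fix_top[OF v(1)] by simp
  moreover have "(code_prod k c \<circ> r (Suc k) ?p) (int ?p') = int ?T"
    unfolding eq using r_top[OF v(5,6)] fix_top[OF v(4)] by simp
  moreover have "inj (code_prod k c \<circ> r (Suc k) ?p)"
    using code_prod_G[OF Suc.prems(1)] G_pos pos_perms_signed signed_permsD(3)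
    unfolding code_prod_Suc by blast
  ultimately have p: "?p = ?p'" by (metis injD of_nat_eq_iff)
  have "r (Suc k) ?p \<in> signed_perms ?T" using r_G[OF v(2,3)] G_pos pos_perms_signed by blast
  then have "code_prod k c = code_prod k c \<circ> r (Suc k) ?p \<circ> inv (r (Suc k) ?p)"
    and "code_prod k c' = code_prod k c' \<circ> r (Suc k) ?p \<circ> inv (r (Suc k) ?p)"
    by (simp_all only: comp_assoc signed_permsD(7) comp_id)
  then have "code_prod k c = code_prod k c'" using eq p by metis
  then show ?case using Suc.IH v Suc.prems(4) p by (cases "j = Suc k") auto
qed simp

text \<open>This evaluates the definite descriptions in \<open>S_canon\<close> and
  \<open>A_canon\<close>: any competing list of factors is itself read as a code, and codes are
  unique.\<close>

lemma canonical_eq: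
  assumes "valid k c" "\<And>j. 1 \<le> j \<Longrightarrow> R j = {r j p | p. 1 \<le> p \<and> p \<le> j + d}"
  shows "(THE ws. length ws = k \<and> (\<forall>j \<in> {1..k}. ws ! (j - 1) \<in> R j) \<and> group_prod ws = code_prod k c)
    = map (\<lambda>j. r j (c j)) [1..<Suc k]"
proof (rule the_equality)
  have "map (\<lambda>j. r j (c j)) [1..<Suc k] ! (j - 1) = r j (c j)" if "j \<in> {1..k}" for j
    using that nth_upt[of 1 "j - 1" "Suc k"] by (subst nth_map) (auto simp del: upt_Suc)
  then show "length (map (\<lambda>j. r j (c j)) [1..<Suc k]) = k \<and>
    (\<forall>j \<in> {1..k}. map (\<lambda>j. r j (c j)) [1..<Suc k] ! (j - 1) \<in> R j) \<and>
    group_prod (map (\<lambda>j. r j (c j)) [1..<Suc k]) = code_prod k c"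
    using assms by (auto simp: code_prod_def valid_def simp del: upt_Suc)
next
  fix ws assume ws: "length ws = k \<and> (\<forall>j \<in> {1..k}. ws ! (j - 1) \<in> R j) \<and> group_prod ws = code_prod k c"
  have "\<exists>p. ws ! (j - 1) = r j p \<and> 1 \<le> p \<and> p \<le> j + d" if "j \<in> {1..k}" for j
    using ws assms(2)[of j] that by auto
  then obtain b where b: "\<And>j. j \<in> {1..k} \<Longrightarrow> ws ! (j - 1) = r j (b j) \<and> 1 \<le> b j \<and> b j \<le> j + d"
    by metis
  have ws_b: "ws = map (\<lambda>j. r j (b j)) [1..<Suc k]"
  proof (rule nth_equalityI)
    fix i assume "i < length ws"
    then show "ws ! i = map (\<lambda>j. r j (b j)) [1..<Suc k] ! i"
      using ws b[of "Suc i"] by (simp del: upt_Suc)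
  qed (use ws in simp)
  have "valid k b" using b by (auto simp: valid_def)
  moreover have "code_prod k b = code_prod k c" using ws ws_b by (simp add: code_prod_def)
  ultimately have "b j = c j" if "j \<in> {1..k}" for j using code_unique assms(1) that by blast
  then show "ws = map (\<lambda>j. r j (c j)) [1..<Suc k]"
    unfolding ws_b by (intro map_cong) auto
qed

end

lemma pos_perms_1: "pos_perms 1 = {id}"
proof (intro equalityI subsetI)
  fix \<sigma> assume s: "\<sigma> \<in> pos_perms 1"
  have "\<sigma> = id"
    using pos_perms_range[OF s] by (intro signed_perms_ext[of _ 1] pos_perms_signed[OF s] id_signed_perms) force
  then show "\<sigma> \<in> {id}" by simp
qed (simp add: id_pos_perms)

interpretation S: factor_tower "\<lambda>j. pos_perms (Suc j)" s_desc "Suc 0"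
proof
  show "pos_perms (Suc 0) = {id}" using pos_perms_1 by simp
  show "g \<in> pos_perms (Suc j)" if "g \<in> pos_perms (Suc (Suc j))" "g (int (Suc j + Suc 0)) = int (Suc j + Suc 0)" for g j
    using pos_perms_drop[OF that(1)] that(2) by simp
  show "s_desc (Suc j) p \<in> pos_perms (Suc (Suc j))" if "1 \<le> p" "p \<le> Suc j + Suc 0" for p j
    using s_desc_pos_perms that by simp
qed (use pos_perms_mono in \<open>auto intro: pos_perms_comp pos_perms_inv simp: s_desc_apply\<close>)

lemma alt_perms_2: "alt_perms 2 = {id}"
proof (intro equalityI subsetI)
  fix \<sigma> assume s: "\<sigma> \<in> alt_perms 2"
  then have "\<sigma> \<in> pos_perms (Suc 1)" by (simp add: alt_perms_def numeral_2_eq_2)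
  \<comment> \<open>The symmetric tower lists the two elements of \<open>S_2\<close>; parity then
    excludes \<open>s_1\<close>.\<close>
  then obtain c where c: "S.valid 1 c" "S.code_prod 1 c = \<sigma>" using S.code_exists by blast
  have l: "1 \<le> c 1" "c 1 \<le> Suc 1" using c(1) by (auto simp: S.valid_def)
  have e: "\<sigma> = s_desc 1 (c 1)"
    using S.code_prod_Suc[of 0 c] c(2) S.code_prod_0 by simp
  have "even (Suc 1 - c 1)" using evenperm_s_desc[OF l] s e by (simp add: alt_perms_def numeral_2_eq_2)
  then have "c 1 = Suc 1" using l by (cases "c 1 = 1") auto
  then show "\<sigma> \<in> {id}" using e s_desc_trivial[of 1] by simp
qed (simp add: alt_perms_def id_pos_perms abs_perm_id)

interpretation A: factor_tower "\<lambda>j. alt_perms (Suc (Suc j))" a_factor 2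
proof
  show "alt_perms (Suc (Suc 0)) = {id}" using alt_perms_2 by (simp add: numeral_2_eq_2)
  show "alt_perms (Suc (Suc j)) \<subseteq> pos_perms (j + 2)" for j by (auto simp: alt_perms_def)
  show "g \<in> alt_perms (Suc (Suc j))"
    if "g \<in> alt_perms (Suc (Suc (Suc j)))" "g (int (Suc j + 2)) = int (Suc j + 2)" for g j
    using alt_perms_drop[OF that(1)] that(2) by simp
  show "a_factor (Suc j) p \<in> alt_perms (Suc (Suc (Suc j)))" if "1 \<le> p" "p \<le> Suc j + 2" for p j
    using a_factor_alt_perms[of p "Suc j"] that by simp
  show "a_factor (Suc j) p (int p) = int (Suc j + 2)" if "1 \<le> p" "p \<le> Suc j + 2" for p j
    using a_factor_apply[of p "Suc j"] that by simp
  show "alt_perms (Suc (Suc j)) \<subseteq> alt_perms (Suc (Suc (Suc j)))" for j by (rule alt_perms_mono) simp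
qed (auto intro: alt_perms_comp alt_perms_inv)

subsection \<open>Windows and the map \<open>\<Psi>\<close>\<close>

lemma length_window [simp]: "length (window m \<sigma>) = m"
  by (simp add: window_def)

lemma nth_window: "i < m \<Longrightarrow> window m \<sigma> ! i = \<sigma> (int i + 1)"
  by (simp add: window_def add.commute)

lemma set_window: "set (window m \<sigma>) = \<sigma> ` {1..int m}"
  by (simp add: window_def)

lemma window_Suc: "window (Suc m) \<sigma> = window m \<sigma> @ [\<sigma> (int m + 1)]"
  by (simp add: window_def upto_rec2[of 1 "1 + int m"] add.commute)

lemma window_comp: "window m (\<sigma> \<circ> \<tau>) = map \<sigma> (window m \<tau>)"
  by (simp add: window_def)

lemma distinct_window: "\<sigma> \<in> signed_perms m \<Longrightarrow> distinct (window m \<sigma>)"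
  using signed_permsD(3) by (auto simp: window_def distinct_map intro: inj_on_subset)

lemma window_inject:
  assumes "\<sigma> \<in> signed_perms m" "\<tau> \<in> signed_perms m" "window m \<sigma> = window m \<tau>"
  shows "\<sigma> = \<tau>"
  using assms by (intro signed_perms_ext[of _ m]) (auto simp: window_def)

text \<open>The cycle \<open>s_desc m l\<close> frees position \<open>l\<close> for the top value,
  which \<open>h\<close> fixes, and moves the later entries one place to the right. Windows count
  from 1, \<open>insert_at\<close> from 0.\<close>

lemma window_comp_s_desc:
  assumes "h \<in> pos_perms m" "1 \<le> l" "l \<le> Suc m"
  shows "window (Suc m) (h \<circ> s_desc m l) = insert_at (l - 1) (int (Suc m)) (window m h)"
proof (rule nth_equalityI)
  show "length (window (Suc m) (h \<circ> s_desc m l)) = length (insert_at (l - 1) (int (Suc m)) (window m h))"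
    using assms by (simp add: insert_at_def)
next
  fix i assume "i < length (window (Suc m) (h \<circ> s_desc m l))"
  then have i: "i < Suc m" by simp
  have top: "h (int m + 1) = int m + 1"
    using signed_perms_fix[OF pos_perms_signed[OF assms(1)]] by simp
  have lhs: "window (Suc m) (h \<circ> s_desc m l) ! i = h (s_desc m l (int i + 1))"
    using i by (simp add: nth_window)
  consider "i < l - 1" | "i = l - 1" | i' where "l - 1 < i" "i = Suc i'"
    by (metis less_imp_Suc_add linorder_neqE_nat)
  then show "window (Suc m) (h \<circ> s_desc m l) ! i = insert_at (l - 1) (int (Suc m)) (window m h) ! i"
  proof cases
    case 1
    then have "s_desc m l (int i + 1) = int i + 1" using assms i by (auto simp: s_desc_apply)
    then show ?thesis unfolding lhs using 1 assms by (simp add: insert_at_def nth_append nth_window)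
  next
    case 2
    then have "s_desc m l (int i + 1) = int m + 1" using assms i by (simp add: s_desc_apply)
    then show ?thesis unfolding lhs using 2 assms top by (simp add: insert_at_def nth_append)
  next
    case 3
    then have "s_desc m l (int i + 1) = int i" using assms i by (auto simp: s_desc_apply)
    moreover have "i - (l - 1) = Suc (i' - (l - 1))" using 3 by simp
    ultimately show ?thesis unfolding lhs using 3 assms i
      by (simp add: insert_at_def nth_append nth_window add.commute)
  qed
qed

text \<open>Right multiplication by \<open>s_1\<close> exchanges the first two letters, and the
  first comparison of a pass is symmetric in them.\<close>

lemma bubble_window_gen_s:
  assumes "2 \<le> m" shows "bubble (window m (\<sigma> \<circ> gen_s 1)) = bubble (window m \<sigma>)"
proof -
  have w: "window m \<tau> = \<tau> 1 # \<tau> 2 # map \<tau> [3..int m]" for \<tau>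
    using assms by (simp add: window_def upto_rec1)
  have "map (\<sigma> \<circ> gen_s 1) [3..int m] = map \<sigma> [3..int m]"
    by (simp add: gen_s_eq)
  then show ?thesis unfolding w by (simp only:) (simp add: gen_s_eq max.commute min.commute)
qed

section \<open>Canonical factors indexed by insertion positions\<close>

lemma R_S_eq: "R_S j = {s_desc j p | p. 1 \<le> p \<and> p \<le> j + Suc 0}"
  by (simp add: R_S_def)

text \<open>The product down to \<open>a_l\<close> is the factor for \<open>p = l + 1\<close>, and
  the exceptional one ending in the inverse of \<open>a_1\<close> takes the remaining value
  \<open>p = 1\<close>.\<close>

lemma R_A_eq:
  assumes "1 \<le> j" shows "R_A j = {a_factor j p | p. 1 \<le> p \<and> p \<le> j + 2}"
proof (intro equalityI subsetI)
  fix x assume "x \<in> R_A j"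
  then consider l where "x = a_desc j l" "1 \<le> l" "l \<le> j + 1" | "x = a_desc_inv j"
    by (auto simp: R_A_def)
  then show "x \<in> {a_factor j p | p. 1 \<le> p \<and> p \<le> j + 2}"
  proof cases
    case 1
    then show ?thesis by (intro CollectI exI[of _ "Suc l"]) (simp add: a_desc_eq_a_factor)
  next
    case 2
    then show ?thesis using assms by (intro CollectI exI[of _ 1]) (simp add: a_desc_inv_eq_a_factor)
  qed
next
  fix x assume "x \<in> {a_factor j p | p. 1 \<le> p \<and> p \<le> j + 2}"
  then obtain p where p: "x = a_factor j p" "1 \<le> p" "p \<le> j + 2" by blast
  show "x \<in> R_A j"
  proof (cases "p = 1")
    case True
    then show ?thesis using p assms by (simp add: R_A_def a_desc_inv_eq_a_factor)
  next
    case False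
    then have "x = a_desc j (p - 1)" "1 \<le> p - 1" "p - 1 \<le> j + 1"
      using p a_desc_eq_a_factor[of "p - 1" j] by auto
    then show ?thesis by (auto simp: R_A_def)
  qed
qed

lemma S_canon_code_prod:
  assumes "S.valid k l"
  shows "S_canon (Suc k) (S.code_prod k l) = map (\<lambda>j. s_desc j (l j)) [1..<Suc k]"
  unfolding S_canon_def diff_Suc_1 by (rule S.canonical_eq[OF assms R_S_eq])

lemma A_canon_code_prod:
  assumes "A.valid k c"
  shows "A_canon (Suc k) (A.code_prod k c) = map (\<lambda>j. a_factor j (c j)) [1..<Suc k]"
  unfolding A_canon_def diff_Suc_1 by (rule A.canonical_eq[OF assms R_A_eq])

lemma a_factor_inj:
  assumes "1 \<le> j" "1 \<le> p" "p \<le> j + 2" "1 \<le> q" "q \<le> j + 2" "a_factor j p = a_factor j q"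
  shows "p = q"
  using assms A.r_inj[of p "j - 1" q] by simp

lemma s_desc_inj:
  assumes "1 \<le> j" "1 \<le> p" "p \<le> j + 1" "1 \<le> q" "q \<le> j + 1" "s_desc j p = s_desc j q"
  shows "p = q"
  using assms S.r_inj[of p "j - 1" q] by simp

lemma f_factor_a_factor:
  assumes "1 \<le> j" "1 \<le> p" "p \<le> j + 2"
  shows "f_factor j (a_factor j p) = s_desc j (max 1 (p - 1))"
proof (cases "p = 1")
  case True
  then show ?thesis using assms by (simp add: f_factor_def a_desc_inv_eq_a_factor)
next
  case False
  have "(THE l. 1 \<le> l \<and> l \<le> j + 1 \<and> a_factor j p = a_desc j l) = p - 1"
  proof (rule the_equality)
    show "1 \<le> p - 1 \<and> p - 1 \<le> j + 1 \<and> a_factor j p = a_desc j (p - 1)"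
      using assms False a_desc_eq_a_factor[of "p - 1" j] by auto
    show "l = p - 1" if "1 \<le> l \<and> l \<le> j + 1 \<and> a_factor j p = a_desc j l" for l
      using that a_desc_eq_a_factor[of l j] a_factor_inj[of j p "Suc l"] assms by auto
  qed
  moreover have "a_factor j p \<noteq> a_desc_inv j"
    using a_factor_inj[of j p 1] assms False by (auto simp: a_desc_inv_eq_a_factor)
  moreover have "max 1 (p - 1) = p - 1" using False assms(2) by simp
  ultimately show ?thesis by (simp add: f_factor_def)
qed

text \<open>In terms of insertion positions, \<open>f\<close> identifies positions 1 and 2, and \<open>g\<^sub>u\<close> recovers the lost
  choice from \<open>u\<close>.\<close>

definition f_code :: "(nat \<Rightarrow> nat) \<Rightarrow> nat \<Rightarrow> nat" where
  "f_code c j = max 1 (c j - 1)"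

definition g_code :: "(nat \<Rightarrow> nat) \<Rightarrow> (nat \<Rightarrow> nat) \<Rightarrow> nat \<Rightarrow> nat" where
  "g_code c l j = (if l j = 1 then c j else Suc (l j))"

lemma valid_f_code: "A.valid k c \<Longrightarrow> S.valid k (f_code c)"
  unfolding A.valid_def S.valid_def f_code_def by fastforce

lemma valid_g_code: "A.valid k c \<Longrightarrow> S.valid k l \<Longrightarrow> A.valid k (g_code c l)"
  unfolding A.valid_def S.valid_def g_code_def by fastforce

lemma nth_map_upt: "j \<in> {1..k} \<Longrightarrow> map f [1..<Suc k] ! (j - 1) = f j"
  by (subst nth_map) (auto simp del: upt_Suc)

lemma f_map_code_prod:
  assumes "A.valid k c"
  shows "f_map (Suc k) (A.code_prod k c) = S.code_prod k (f_code c)"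
  unfolding f_map_def S.code_prod_def A_canon_code_prod[OF assms]
proof (intro arg_cong[where f = group_prod] map_cong refl)
  fix j assume "j \<in> set [1..<Suc k]"
  then have j: "j \<in> {1..k}" by auto
  then show "f_factor j (map (\<lambda>j. a_factor j (c j)) [1..<Suc k] ! (j - 1)) = s_desc j (f_code c j)"
    using assms f_factor_a_factor[of j "c j"] unfolding nth_map_upt[OF j] A.valid_def f_code_def
    by auto
qed

lemma g_map_code_prod:
  assumes "A.valid k c" "S.valid k l"
  shows "g_map (Suc k) (A.code_prod k c) (S.code_prod k l) = A.code_prod k (g_code c l)"
  unfolding g_map_def A.code_prod_def[of k "g_code c l"] S_canon_code_prod[OF assms(2)]
proof (intro arg_cong[where f = group_prod] map_cong refl)
  fix j assume "j \<in> set [1..<Suc k]"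
  then have j: "j \<in> {1..k}" "1 \<le> j" by auto
  have l: "1 \<le> l j" "l j \<le> j + 1" using assms(2) j unfolding S.valid_def by auto
  have "g_factor (Suc k) (A.code_prod k c) j (s_desc j (l j)) = a_factor j (g_code c l j)"
  proof (cases "l j = 1")
    case True
    then show ?thesis
      by (simp only: g_factor_def A_canon_code_prod[OF assms(1)] nth_map_upt[OF j(1)] g_code_def if_True refl)
  next
    case False
    have "(THE i. 2 \<le> i \<and> i \<le> j + 1 \<and> s_desc j (l j) = s_desc j i) = l j"
    proof (rule the_equality)
      show "i = l j" if "2 \<le> i \<and> i \<le> j + 1 \<and> s_desc j (l j) = s_desc j i" for i
        using s_desc_inj[of j "l j" i] that l j by auto
    qed (use l False in auto)
    moreover have "s_desc j (l j) \<noteq> s_desc j 1" using s_desc_inj[of j "l j" 1] l j False by auto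
    ultimately show ?thesis using False l a_desc_eq_a_factor[of "l j" j]
      by (simp add: g_factor_def g_code_def)
  qed
  then show "g_factor (Suc k) (A.code_prod k c) j (map (\<lambda>j. s_desc j (l j)) [1..<Suc k] ! (j - 1)) =
      a_factor j (g_code c l j)"
    unfolding nth_map_upt[OF j(1)] .
qed

lemma window_pos_perms_less:
  assumes "h \<in> pos_perms m" "x \<in> set (window m h)" shows "x < int (Suc m)"
  using assms pos_perms_range by (fastforce simp: set_window)

lemma window_S_code_prod_Suc:
  assumes "S.valid (Suc k) l"
  shows "window (Suc (Suc k)) (S.code_prod (Suc k) l) =
    insert_at (l (Suc k) - 1) (int (Suc (Suc k))) (window (Suc k) (S.code_prod k l))"
  unfolding S.code_prod_Suc
  using assms S.code_prod_G[of k l] by (intro window_comp_s_desc) (auto simp: S.valid_Suc)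

text \<open>The factor with index \<open>j\<close> inserts the value \<open>j + 1\<close>, larger
  than all values present. It becomes a left-to-right minimum iff it goes to the front, and later
  insertions of larger values do not change this.\<close>

lemma lr_minima_window_code_prod:
  "S.valid k l \<Longrightarrow> lr_minima (window (Suc k) (S.code_prod k l)) =
    insert 1 ((\<lambda>j. int j + 1) ` {j \<in> {1..k}. l j = 1})"
proof (induction k)
  case 0
  then show ?case by (simp add: S.code_prod_0 window_def)
next
  case (Suc k)
  have v: "S.valid k l" "1 \<le> l (Suc k)" "l (Suc k) \<le> Suc (Suc k)"
    using Suc.prems by (auto simp: S.valid_Suc)
  let ?w = "window (Suc k) (S.code_prod k l)"
  have "lr_minima (window (Suc (Suc k)) (S.code_prod (Suc k) l)) =
      (if l (Suc k) - 1 = 0 then insert (int (Suc (Suc k))) (lr_minima ?w) else lr_minima ?w)"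
    unfolding window_S_code_prod_Suc[OF Suc.prems]
  proof (rule lr_minima_insert_at)
    show "?w \<noteq> []" by (metis length_window list.size(3) nat.distinct(1))
  qed (use v window_pos_perms_less[OF S.code_prod_G[OF v(1)]] in auto)
  moreover have "{j \<in> {1..Suc k}. l j = 1} =
      (if l (Suc k) = 1 then insert (Suc k) {j \<in> {1..k}. l j = 1} else {j \<in> {1..k}. l j = 1})"
    by (auto simp: le_Suc_eq)
  ultimately show ?case using Suc.IH[OF v(1)] v(2) by auto
qed

text \<open>Both windows grow by inserting a largest letter. A pass moves the insertion one place
  towards the front and merges the first two positions, which is the effect of
  \<open>f_code\<close>.\<close>

lemma window_f_code:
  "A.valid k c \<Longrightarrow> window (Suc k) (S.code_prod k (f_code c)) =
    map (\<lambda>x. x - 1) (bubble (window (Suc (Suc k)) (A.code_prod k c)))"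
proof (induction k)
  case 0
  then show ?case by (simp add: S.code_prod_0 A.code_prod_0 window_def upto_rec1)
next
  case (Suc k)
  define p where "p = c (Suc k)"
  have v: "A.valid k c" "1 \<le> p" "p \<le> Suc (Suc (Suc k))"
    using Suc.prems by (auto simp: A.valid_Suc p_def)
  \<comment> \<open>The possible \<open>s_1\<close> at the left of the last factor is moved to the
    preceding product, where it merely exchanges the first two letters of the window and is
    invisible to a pass.\<close>
  define h where "h = A.code_prod k c \<circ> (if even (Suc k + p) then id else gen_s 1)"
  have "A.code_prod k c \<in> pos_perms (Suc (Suc k))"
    using A.code_prod_G[OF v(1)] by (simp add: alt_perms_def)
  then have h: "h \<in> pos_perms (Suc (Suc k))"
    unfolding h_def by (auto intro!: pos_perms_comp gen_s_pos_perms id_pos_perms)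
  have bh: "bubble (window (Suc (Suc k)) h) = bubble (window (Suc (Suc k)) (A.code_prod k c))"
    unfolding h_def using bubble_window_gen_s by simp
  let ?w = "window (Suc (Suc k)) h"
  have "window (Suc (Suc (Suc k))) (A.code_prod (Suc k) c) =
      window (Suc (Suc (Suc k))) (h \<circ> s_desc (Suc (Suc k)) p)"
    by (simp only: A.code_prod_Suc a_factor_def h_def p_def comp_assoc)
  also have "\<dots> = insert_at (p - 1) (int (Suc (Suc (Suc k)))) ?w"
    by (rule window_comp_s_desc[OF h v(2,3)])
  also have "bubble \<dots> = insert_at (p - 1 - 1) (int (Suc (Suc (Suc k)))) (bubble ?w)"
  proof (rule bubble_insert_at)
    show "?w \<noteq> []" by (metis length_window list.size(3) nat.distinct(1))
  qed (use v window_pos_perms_less[OF h] in auto)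
  also have "map (\<lambda>x. x - 1) \<dots> = insert_at (p - 1 - 1) (int (Suc (Suc k))) (map (\<lambda>x. x - 1) (bubble ?w))"
    by (simp add: insert_at_def take_map drop_map)
  also have "map (\<lambda>x. x - 1) (bubble ?w) = window (Suc k) (S.code_prod k (f_code c))"
    using Suc.IH[OF v(1)] bh by simp
  also have "p - 1 - 1 = f_code c (Suc k) - 1" by (simp add: f_code_def p_def max_def)
  finally show ?case
    using window_S_code_prod_Suc[OF valid_f_code[OF Suc.prems]] by simp
qed

lemma of_window_signed_perms:
  assumes "distinct (map abs xs)" "set (map abs xs) = {1..int (length xs)}"
  shows "of_window xs \<in> signed_perms (length xs)"
proof -
  let ?m = "int (length xs)"
  let ?D = "{- ?m..?m} - {0}"
  have odd: "of_window xs (- i) = - of_window xs i" for i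
    by (auto simp: of_window_def sgn_if)
  have nth: "of_window xs i = sgn i * xs ! (nat \<bar>i\<bar> - 1)" "nat \<bar>i\<bar> - 1 < length xs" if "i \<in> ?D" for i
    using that by (auto simp: of_window_def)
  have abs: "\<bar>of_window xs i\<bar> = map abs xs ! (nat \<bar>i\<bar> - 1)" if "i \<in> ?D" for i
    using that nth[OF that] by (auto simp: abs_mult)
  have "\<bar>of_window xs i\<bar> \<in> {1..?m}" if "i \<in> ?D" for i
    using abs[OF that] nth(2)[OF that] assms(2) by (metis length_map nth_mem)
  then have into: "of_window xs ` ?D \<subseteq> ?D" by fastforce
  have "inj_on (of_window xs) ?D"
  proof (rule inj_onI)
    fix i j assume ij: "i \<in> ?D" "j \<in> ?D" "of_window xs i = of_window xs j"
    then have "map abs xs ! (nat \<bar>i\<bar> - 1) = map abs xs ! (nat \<bar>j\<bar> - 1)" using abs by metis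
    then have n: "nat \<bar>i\<bar> - 1 = nat \<bar>j\<bar> - 1"
      using nth(2)[OF ij(1)] nth(2)[OF ij(2)] assms(1) by (simp add: nth_eq_iff_index_eq del: nth_map)
    then have "\<bar>i\<bar> = \<bar>j\<bar>" using ij(1,2) by auto
    moreover have "of_window xs j \<in> ?D" using into ij(2) by blast
    then have "sgn i = sgn j" using nth(1)[OF ij(1)] nth(1)[OF ij(2)] ij(3) n by auto
    ultimately show "i = j" by (metis abs_mult_sgn mult.commute)
  qed
  then have "bij_betw (of_window xs) ?D ?D" using into by (simp add: bij_betw_def endo_inj_surj)
  then have "of_window xs permutes ?D"
    by (rule bij_imp_permutes) (auto simp: of_window_def)
  then show ?thesis using odd by (simp add: signed_perms_def)
qed

lemma window_of_window: "window (length xs) (of_window xs) = xs"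
  by (rule nth_equalityI) (auto simp: nth_window of_window_def sgn_if nat_add_distrib)

lemma of_window_pos_perms:
  assumes "distinct xs" "set xs = {1..int (length xs)}"
  shows "of_window xs \<in> pos_perms (length xs)"
proof -
  have e: "map abs xs = xs" using assms(2) by (intro map_idI) auto
  have "0 < of_window xs i" if "0 < i" for i
  proof (cases "i \<le> int (length xs)")
    case True
    then have "of_window xs i = xs ! (nat i - 1)" "nat i - 1 < length xs" using that by (auto simp: of_window_def)
    then have "of_window xs i \<in> set xs" by simp
    then show ?thesis using assms(2) by auto
  qed (use that in \<open>auto simp: of_window_def\<close>)
  then show ?thesis using of_window_signed_perms[of xs] assms e by (simp add: pos_perms_def)
qed

text \<open>The code \<open>l\<close> of the reversed Foata image has its entries 1 at the same
  indices as \<open>f_code c\<close>, because these indices are encoded by the left-to-right minima.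
  So the choices stored in \<open>c\<close> are called upon exactly where \<open>f\<close> forgot
  them.\<close>

lemma Psi_code_prod:
  assumes "A.valid k c"
  obtains l where "S.valid k l" "Psi (Suc k) (A.code_prod k c) = A.code_prod k (g_code c l)"
    "window (Suc k) (S.code_prod k l) = rev_foata (window (Suc k) (S.code_prod k (f_code c)))"
    "\<And>j. j \<in> {1..k} \<Longrightarrow> l j = 1 \<longleftrightarrow> f_code c j = 1"
proof -
  define w where "w = window (Suc k) (S.code_prod k (f_code c))"
  note F = valid_f_code[OF assms]
  have wp: "S.code_prod k (f_code c) \<in> pos_perms (Suc k)" using S.code_prod_G[OF F] .
  have m: "mset (rev_foata w) = mset w" by (rule mset_rev_foata)
  have len: "length (rev_foata w) = Suc k" using m by (metis length_window size_mset w_def)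
  have "distinct (rev_foata w)"
    using distinct_window[OF pos_perms_signed[OF wp]] m mset_eq_imp_distinct_iff w_def by blast
  moreover have "set (rev_foata w) = {1..int (length (rev_foata w))}"
    using m pos_perms_image[OF wp] len by (metis set_mset_mset set_window w_def)
  ultimately have "of_window (rev_foata w) \<in> pos_perms (Suc k)"
    using of_window_pos_perms[of "rev_foata w"] len by simp
  then obtain l where l: "S.valid k l" "S.code_prod k l = of_window (rev_foata w)"
    using S.code_exists by blast
  have win: "window (Suc k) (S.code_prod k l) = rev_foata w"
    using window_of_window[of "rev_foata w"] len l(2) by simp
  have "lr_minima (rev_foata w) = lr_minima w" by (rule lr_minima_rev_foata)
  then have eq: "insert 1 ((\<lambda>j. int j + 1) ` {j \<in> {1..k}. l j = 1}) =
      insert 1 ((\<lambda>j. int j + 1) ` {j \<in> {1..k}. f_code c j = 1})"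
    using lr_minima_window_code_prod[OF l(1)] lr_minima_window_code_prod[OF F] win w_def by simp
  have iff: "l j = 1 \<longleftrightarrow> f_code c j = 1" if "j \<in> {1..k}" for j
  proof -
    \<comment> \<open>Since \<open>j\<close> is at least 1, the value \<open>j + 1\<close> is never
      the extra element 1.\<close>
    have mem: "int j + 1 \<in> insert 1 ((\<lambda>j. int j + 1) ` {j \<in> {1..k}. b j = 1}) \<longleftrightarrow> b j = 1" for b :: "nat \<Rightarrow> nat"
      using that by auto
    show ?thesis using mem[of l] mem[of "f_code c"] eq by metis
  qed
  have "Psi (Suc k) (A.code_prod k c) = A.code_prod k (g_code c l)"
    unfolding Psi_def f_map_code_prod[OF assms] w_def[symmetric] l(2)[symmetric]
    by (rule g_map_code_prod[OF assms l(1)])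
  then show ?thesis using that l(1) win iff unfolding w_def by blast
qed

text \<open>Where \<open>l j = 1\<close>, the inserted entry \<open>c j\<close> is sent to 1 by the
  compatibility of \<open>l\<close> with \<open>c\<close>; elsewhere the successor taken by
  \<open>g_code\<close> is undone. Hence \<open>f\<close> after \<open>Psi\<close> yields the
  reversed Foata image.\<close>

lemma f_code_g_code:
  assumes "S.valid k l" "\<And>j. j \<in> {1..k} \<Longrightarrow> l j = 1 \<longleftrightarrow> f_code c j = 1" "j \<in> {1..k}"
  shows "f_code (g_code c l) j = l j"
proof (cases "l j = 1")
  case True
  then show ?thesis using assms(2)[OF assms(3)] by (simp add: f_code_def g_code_def)
next
  case False
  moreover have "1 \<le> l j" using assms(1,3) unfolding S.valid_def by auto
  ultimately show ?thesis by (simp add: f_code_def g_code_def max_def)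
qed

lemma Psi_alt_perms:
  assumes "v \<in> alt_perms (Suc (Suc k))"
  shows "Psi (Suc k) v \<in> alt_perms (Suc (Suc k))"
    and "map (\<lambda>x. x - 1) (bubble (window (Suc (Suc k)) (Psi (Suc k) v))) =
      rev_foata (map (\<lambda>x. x - 1) (bubble (window (Suc (Suc k)) v)))"
proof -
  obtain c where c: "A.valid k c" "A.code_prod k c = v" using A.code_exists[OF assms] by blast
  obtain l where l: "S.valid k l" "Psi (Suc k) (A.code_prod k c) = A.code_prod k (g_code c l)"
    "window (Suc k) (S.code_prod k l) = rev_foata (window (Suc k) (S.code_prod k (f_code c)))"
    "\<And>j. j \<in> {1..k} \<Longrightarrow> l j = 1 \<longleftrightarrow> f_code c j = 1"
    using Psi_code_prod[OF c(1)] by blast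
  note G = valid_g_code[OF c(1) l(1)]
  show "Psi (Suc k) v \<in> alt_perms (Suc (Suc k))" using A.code_prod_G[OF G] l(2) c(2) by simp
  have "S.code_prod k (f_code (g_code c l)) = S.code_prod k l"
    by (intro S.code_prod_cong f_code_g_code[OF l(1) l(4)])
  then show "map (\<lambda>x. x - 1) (bubble (window (Suc (Suc k)) (Psi (Suc k) v))) =
      rev_foata (map (\<lambda>x. x - 1) (bubble (window (Suc (Suc k)) v)))"
    using window_f_code[OF G] window_f_code[OF c(1)] l(2,3) c(2) by simp
qed

lemma Psi_inject:
  assumes "v \<in> alt_perms (Suc (Suc k))" "v' \<in> alt_perms (Suc (Suc k))" "Psi (Suc k) v = Psi (Suc k) v'"
  shows "v = v'"
proof -
  obtain c where c: "A.valid k c" "A.code_prod k c = v" using A.code_exists[OF assms(1)] by blast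
  obtain c' where c': "A.valid k c'" "A.code_prod k c' = v'" using A.code_exists[OF assms(2)] by blast
  obtain l where l: "S.valid k l" "Psi (Suc k) (A.code_prod k c) = A.code_prod k (g_code c l)"
    "\<And>j. j \<in> {1..k} \<Longrightarrow> l j = 1 \<longleftrightarrow> f_code c j = 1"
    using Psi_code_prod[OF c(1)] by blast
  obtain l' where l': "S.valid k l'" "Psi (Suc k) (A.code_prod k c') = A.code_prod k (g_code c' l')"
    "\<And>j. j \<in> {1..k} \<Longrightarrow> l' j = 1 \<longleftrightarrow> f_code c' j = 1"
    using Psi_code_prod[OF c'(1)] by blast
  have g: "g_code c l j = g_code c' l' j" if "j \<in> {1..k}" for j
    using A.code_unique[OF valid_g_code[OF c(1) l(1)] valid_g_code[OF c'(1) l'(1)] _ that]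
      l(2) l'(2) c(2) c'(2) assms(3) by simp
  \<comment> \<open>The window of \<open>Psi\<close> determines the reversed Foata image of
    \<open>f\<close>, and that transformation is injective; so \<open>f_code c\<close> and
    \<open>f_code c'\<close> will agree.\<close>
  have "rev_foata (map (\<lambda>x. x - 1) (bubble (window (Suc (Suc k)) v))) =
      rev_foata (map (\<lambda>x. x - 1) (bubble (window (Suc (Suc k)) v')))"
    using Psi_alt_perms(2)[OF assms(1)] Psi_alt_perms(2)[OF assms(2)] assms(3) by simp
  then have "window (Suc k) (S.code_prod k (f_code c)) = window (Suc k) (S.code_prod k (f_code c'))"
    using rev_foata_inject window_f_code[OF c(1)] window_f_code[OF c'(1)] c(2) c'(2) by metis
  then have "S.code_prod k (f_code c) = S.code_prod k (f_code c')"
    using S.code_prod_G[OF valid_f_code[OF c(1)]] S.code_prod_G[OF valid_f_code[OF c'(1)]]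
    by (intro window_inject) (auto intro: pos_perms_signed)
  then have f: "f_code c j = f_code c' j" if "j \<in> {1..k}" for j
    using S.code_unique[OF valid_f_code[OF c(1)] valid_f_code[OF c'(1)] _ that] by simp
  \<comment> \<open>An entry of \<open>f_code\<close> above 1 determines \<open>c j\<close>; where
    it is 1, \<open>g_code\<close> has kept \<open>c j\<close> itself.\<close>
  have "c j = c' j" if "j \<in> {1..k}" for j
  proof (cases "f_code c j = 1")
    case True
    then show ?thesis using g[OF that] l(3)[OF that] l'(3)[OF that] f[OF that] by (simp add: g_code_def)
  next
    case False
    then show ?thesis using f[OF that] by (auto simp: f_code_def max_def split: if_splits)
  qed
  then have "A.code_prod k c = A.code_prod k c'" by (rule A.code_prod_cong)
  then show ?thesis using c(2) c'(2) by simp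
qed

subsection \<open>The statistics on \<open>L\<^sub>n\<^sub>+\<^sub>1\<close> and the map \<open>\<Theta>\<close>\<close>

text \<open>Letters are added one at a time: \<open>del_B\<close> grows exactly when the new letter
  is below all earlier ones, the case in which a pass loses one inversion.\<close>

lemma word_inv_window_bubble:
  assumes "inj_on \<sigma> {1..int m}" "1 \<le> m"
  shows "word_inv (window m \<sigma>) = word_inv (bubble (window m \<sigma>)) + del_B m \<sigma>"
  using assms(2,1)
proof (induction m rule: dec_induct)
  case base
  have "del_B 1 \<sigma> = 0" by (simp add: del_B_def)
  then show ?case by (simp add: window_def)
next
  case (step m)
  let ?D = "\<lambda>m. {j \<in> {2..int m}. \<forall>i \<in> {1..<j}. \<sigma> i > \<sigma> j}"
  have IH: "word_inv (window m \<sigma>) = word_inv (bubble (window m \<sigma>)) + del_B m \<sigma>"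
    by (rule step.IH, rule inj_on_subset[OF step.prems]) auto
  have "window m \<sigma> \<noteq> []" using step.hyps(1) by (metis length_window list.size(3) not_one_le_zero)
  moreover have "distinct (window m \<sigma> @ [\<sigma> (int m + 1)])"
    using step.prems unfolding window_Suc[symmetric] by (simp add: window_def distinct_map add.commute)
  ultimately have inv_step: "word_inv (window (Suc m) \<sigma>) = word_inv (bubble (window (Suc m) \<sigma>)) + del_B m \<sigma>
      + (if \<forall>x \<in> set (window m \<sigma>). \<sigma> (int m + 1) < x then 1 else 0)"
    unfolding window_Suc using IH by (intro word_inv_bubble_snoc)
  have "?D (Suc m) = (if \<forall>x \<in> set (window m \<sigma>). \<sigma> (int m + 1) < x
      then insert (int m + 1) (?D m) else ?D m)"
  proof -
    have "{2..int (Suc m)} = insert (int m + 1) {2..int m}" using step.hyps(1) by auto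
    moreover have "(\<forall>x \<in> set (window m \<sigma>). \<sigma> (int m + 1) < x) \<longleftrightarrow>
        (\<forall>i \<in> {1..<int m + 1}. \<sigma> i > \<sigma> (int m + 1))"
      by (auto simp: set_window)
    ultimately show ?thesis by auto
  qed
  moreover have "finite (?D m)" "int m + 1 \<notin> ?D m"
    by (auto intro: finite_subset[of _ "{2..int m}"])
  ultimately have "del_B (Suc m) \<sigma> = del_B m \<sigma> +
      (if \<forall>x \<in> set (window m \<sigma>). \<sigma> (int m + 1) < x then 1 else 0)"
    unfolding del_B_def by (simp only: card_insert_disjoint split: if_split) simp
  with inv_step show ?case by simp
qed

lemma ell_L_bubble:
  assumes "\<sigma> \<in> signed_perms m" "1 \<le> m"
  shows "ell_L m \<sigma> = int (word_inv (bubble (window m \<sigma>))) + (\<Sum>i \<in> Neg_inv m \<sigma>. i)"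
  using word_inv_window_bubble[of \<sigma> m] signed_permsD(3)[OF assms(1)] assms(2)
  by (simp add: ell_L_def inj_on_subset)

lemma Neg_inv_window: "Neg_inv m \<sigma> = {- x | x. x \<in> set (window m \<sigma>) \<and> x < 0}"
  by (auto simp: Neg_inv_def set_window)

lemma set_window_comp_pos_perms:
  assumes "\<tau> \<in> pos_perms m" shows "set (window m (\<sigma> \<circ> \<tau>)) = set (window m \<sigma>)"
  unfolding window_comp set_map set_window pos_perms_image[OF assms] ..

lemma window_comp_gen_s:
  assumes "1 \<le> i" "i + 2 \<le> m"
  obtains us y z vs where "window m \<sigma> = us @ y # z # vs"
    "window m (\<sigma> \<circ> gen_s (Suc i)) = us @ z # y # vs" "length us = i"
proof -
  have "[1..int m] = [1..int i] @ [int i + 1..int m]"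
    using assms by (intro upto_split2[of 1 "int i" "int m", simplified]) auto
  also have "[int i + 1..int m] = (int i + 1) # (int i + 2) # [int i + 3..int m]"
    using assms by (simp add: upto_rec1 add.commute)
  finally have e: "[1..int m] = [1..int i] @ (int i + 1) # (int i + 2) # [int i + 3..int m]" .
  show ?thesis
  proof (rule that)
    show "window m \<sigma> = map \<sigma> [1..int i] @ \<sigma> (int i + 1) # \<sigma> (int i + 2) # map \<sigma> [int i + 3..int m]"
      unfolding window_def e by simp
    show "window m (\<sigma> \<circ> gen_s (Suc i)) =
        map \<sigma> [1..int i] @ \<sigma> (int i + 2) # \<sigma> (int i + 1) # map \<sigma> [int i + 3..int m]"
      unfolding window_def e by (auto simp: gen_s_eq add.commute)
  qed simp
qed

text \<open>The factor \<open>s_1\<close> of \<open>a_i\<close> exchanges the first two letters,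
  which a pass ignores; the other factor then exchanges positions \<open>i + 1\<close> and
  \<open>i + 2\<close>. The set of negative entries stays the same, so only inversions of bubble
  words are compared.\<close>

lemma Des_A_bubble:
  assumes "\<pi> \<in> signed_perms (n + 1)" "1 \<le> i" "i \<le> n - 1"
  shows "i \<in> Des_A n \<pi> \<longleftrightarrow>
    bubble (window (n + 1) \<pi>) ! (i - 1) > bubble (window (n + 1) \<pi>) ! i"
proof -
  have g1: "gen_s 1 \<in> pos_perms (n + 1)" and g2: "gen_s (Suc i) \<in> pos_perms (n + 1)"
    using assms by (auto intro!: gen_s_pos_perms)
  let ?\<rho> = "\<pi> \<circ> gen_s 1"
  have r: "?\<rho> \<in> signed_perms (n + 1)" "?\<rho> \<circ> gen_s (Suc i) \<in> signed_perms (n + 1)"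
    by (intro signed_perms_comp assms(1) pos_perms_signed[OF g1] pos_perms_signed[OF g2])+
  have a: "\<pi> \<circ> gen_a i = ?\<rho> \<circ> gen_s (Suc i)" by (simp add: gen_a_def comp_assoc)
  have "Neg_inv (n + 1) (?\<rho> \<circ> gen_s (Suc i)) = Neg_inv (n + 1) \<pi>"
    unfolding Neg_inv_window set_window_comp_pos_perms[OF g2] set_window_comp_pos_perms[OF g1] ..
  moreover have bub: "bubble (window (n + 1) ?\<rho>) = bubble (window (n + 1) \<pi>)"
    using assms by (intro bubble_window_gen_s) auto
  ultimately have "i \<in> Des_A n \<pi> \<longleftrightarrow>
      word_inv (bubble (window (n + 1) (?\<rho> \<circ> gen_s (Suc i)))) \<le> word_inv (bubble (window (n + 1) ?\<rho>))"
    using assms(2,3) ell_L_bubble[OF r(2)] ell_L_bubble[OF assms(1)]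
    unfolding Des_A_def mem_Collect_eq a by simp
  moreover obtain us y z vs where w: "window (n + 1) ?\<rho> = us @ y # z # vs"
    "window (n + 1) (?\<rho> \<circ> gen_s (Suc i)) = us @ z # y # vs" "length us = i"
    by (rule window_comp_gen_s[of i "n + 1" ?\<rho>]) (use assms(2,3) in auto)
  have "distinct (us @ y # z # vs)" using distinct_window[OF r(1)] w(1) by simp
  moreover have "us \<noteq> []" using w(3) assms(2) by auto
  ultimately show ?thesis using bubble_descent_iff[of us y z vs] w bub by simp
qed

lemma rmaj_bubble:
  assumes "\<pi> \<in> signed_perms (n + 1)"
  shows "rmaj n \<pi> = int (rev_maj (bubble (window (n + 1) \<pi>)))"
proof -
  let ?b = "bubble (window (n + 1) \<pi>)"
  have len: "length ?b = n" by (simp add: length_bubble)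
  have D: "Des_A n \<pi> = {i \<in> {1..n - 1}. ?b ! (i - 1) > ?b ! i}"
    using Des_A_bubble[OF assms] by (auto simp: Des_A_def)
  have "rmaj n \<pi> = (\<Sum>i \<in> Des_A n \<pi>. int (n - i))"
    unfolding rmaj_def by (intro sum.cong) (auto simp: Des_A_def)
  also have "\<dots> = int (\<Sum>i \<in> Des_A n \<pi>. n - i)" by simp
  also have "\<dots> = int (rev_maj ?b)" unfolding rev_maj_eq_sum len D ..
  finally show ?thesis .
qed

text \<open>In an increasing word the entry of largest absolute value \<open>M\<close> stands last
  if positive and first if negative. Removing it is free at the end, and costs \<open>M - 1\<close>
  adjacent transpositions of absolute values at the front, which is its summand.\<close>

lemma evenperm_sorted_window:
  fixes xs :: "int list"
  assumes "sorted_wrt (<) xs" "distinct (map abs xs)" "set (map abs xs) = {1..int (length xs)}"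
  shows "evenperm (abs_perm (length xs) (of_window xs)) \<longleftrightarrow> even (\<Sum>i \<in> {- x | x. x \<in> set xs \<and> x < 0}. i - 1)"
  using assms
proof (induction "length xs" arbitrary: xs)
  case 0
  then show ?case by (simp add: abs_perm_def)
next
  case (Suc m)
  let ?N = "\<lambda>xs. {- x | x :: int. x \<in> set xs \<and> x < 0}"
  have fin: "finite (?N xs)" for xs
    by (rule finite_subset[of _ "uminus ` set xs"]) auto
  have len: "length xs = Suc m" using Suc.hyps(2) by simp
  have "int (Suc m) \<in> abs ` set xs" using Suc.prems(3) len by auto
  then obtain x where x: "x \<in> set xs" "\<bar>x\<bar> = int (Suc m)" by auto
  have bound: "\<bar>y\<bar> \<le> int (Suc m)" if "y \<in> set xs" for y
  proof -
    have "\<bar>y\<bar> \<in> set (map abs xs)" using that by simp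
    then show ?thesis using Suc.prems(3) len by auto
  qed
  show ?case
  proof (cases "0 < x")
    case True
    then have x: "x \<in> set xs" "x = int (Suc m)" using x by auto
    obtain ys z where ys: "xs = ys @ [z]" using len by (cases xs rule: rev_cases) auto
    have "z = x"
    proof (rule ccontr)
      assume "z \<noteq> x"
      then have "x < z" using x(1) ys Suc.prems(1) by (auto simp: sorted_wrt_append)
      then show False using bound[of z] ys x(2) by auto
    qed
    then have ys: "xs = ys @ [int (Suc m)]" "length ys = m" using ys x len by auto
    have "set (map abs xs) = insert (int (Suc m)) (set (map abs ys))"
      "int (Suc m) \<notin> set (map abs ys)"
      using Suc.prems(2) unfolding ys(1) by simp_all
    then have "set (map abs ys) = {1..int (Suc m)} - {int (Suc m)}"
      using Suc.prems(3) unfolding len by (metis Diff_insert_absorb)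
    then have "set (map abs ys) = {1..int (length ys)}" using ys(2) by auto
    then have "evenperm (abs_perm (length ys) (of_window ys)) \<longleftrightarrow> even (\<Sum>i \<in> ?N ys. i - 1)"
      using Suc.hyps(1)[of ys] Suc.prems(1,2) ys by (auto simp: sorted_wrt_append)
    moreover have "?N ys = ?N xs" using ys(1) by auto
    moreover have "abs_perm (length xs) (of_window xs) = abs_perm (length ys) (of_window ys)"
    proof
      fix i
      consider "i \<in> {1..int m}" | "i = int (Suc m)" | "i < 1 \<or> int (Suc m) < i" by force
      then show "abs_perm (length xs) (of_window xs) i = abs_perm (length ys) (of_window ys) i"
        by cases (use ys in \<open>auto simp: abs_perm_def of_window_def nth_append\<close>)
    qed
    ultimately show ?thesis by simp
  next
    case False
    then have x: "x \<in> set xs" "x = - int (Suc m)" using x by auto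
    obtain ys z where ys: "xs = z # ys" using len by (cases xs) auto
    have "z = x"
    proof (rule ccontr)
      assume "z \<noteq> x"
      then have "z < x" using x(1) ys Suc.prems(1) by auto
      then show False using bound[of z] ys x(2) by auto
    qed
    then have ys: "xs = - int (Suc m) # ys" "length ys = m" using ys x len by auto
    have "set (map abs xs) = insert (int (Suc m)) (set (map abs ys))"
      "int (Suc m) \<notin> set (map abs ys)"
      using Suc.prems(2) unfolding ys(1) list.map distinct.simps abs_minus_cancel abs_of_nat by simp_all
    then have "set (map abs ys) = {1..int (Suc m)} - {int (Suc m)}"
      using Suc.prems(3) unfolding len by (metis Diff_insert_absorb)
    then have sy: "set (map abs ys) = {1..int (length ys)}" using ys(2) by auto
    then have IH: "evenperm (abs_perm m (of_window ys)) \<longleftrightarrow> even (\<Sum>i \<in> ?N ys. i - 1)"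
      using Suc.hyps(1)[of ys] Suc.prems(1,2) ys by auto
    have top: "int (Suc m) \<notin> ?N ys"
    proof
      assume "int (Suc m) \<in> ?N ys"
      then obtain x where "int (Suc m) = - x" "x \<in> set ys" by blast
      then show False using Suc.prems(1) ys(1) by auto
    qed
    have neg_insert: "{- x | x :: int. x \<in> insert (- M) A \<and> x < 0} =
        insert M {- x | x. x \<in> A \<and> x < 0}" if "0 < M" for A M
      using that by (auto intro: exI[of _ "- M"])
    have "?N xs = insert (int (Suc m)) (?N ys)"
      unfolding ys(1) list.set by (rule neg_insert) simp
    with top have sum: "(\<Sum>i \<in> ?N xs. i - 1) = int m + (\<Sum>i \<in> ?N ys. i - 1)"
      using fin[of ys] by simp
    have w: "of_window ys \<in> signed_perms m"
      using of_window_signed_perms[of ys] Suc.prems(2) sy ys by simp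
    then have w': "of_window ys \<in> signed_perms (Suc m)" using signed_perms_mono[of m "Suc m"] by auto
    have s: "s_desc m 1 \<in> signed_perms (Suc m)" by (intro pos_perms_signed s_desc_pos_perms) auto
    \<comment> \<open>Up to the sign at position 1, prepending the entry amounts to composing with
      the cycle that carries 1 to \<open>m + 1\<close>.\<close>
    have "abs_perm (Suc m) (of_window xs) = abs_perm (Suc m) (of_window ys \<circ> s_desc m 1)"
    proof
      fix i
      consider "i = 1" | "i \<in> {2..int (Suc m)}" | "i < 1 \<or> int (Suc m) < i" by force
      then show "abs_perm (Suc m) (of_window xs) i = abs_perm (Suc m) (of_window ys \<circ> s_desc m 1) i"
      proof cases
        case 1
        then show ?thesis using ys by (simp add: abs_perm_def s_desc_apply of_window_def)
      next
        case 2
        then have "nat i - 1 = Suc (nat (i - 1) - 1)" by auto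
        then show ?thesis using ys 2 by (simp add: abs_perm_def s_desc_apply of_window_def)
      next
        case 3
        then show ?thesis by (auto simp: abs_perm_def)
      qed
    qed
    then have "evenperm (abs_perm (Suc m) (of_window xs)) \<longleftrightarrow>
        (evenperm (abs_perm m (of_window ys)) \<longleftrightarrow> even m)"
      using evenperm_abs_perm_comp[OF w' s] evenperm_s_desc[of 1 m] abs_perm_mono[OF w, of "Suc m"] by simp
    then show ?thesis using IH sum len by auto
  qed
qed

section \<open>The sorting factor and the quotient by it\<close>

lemma window_abs:
  assumes "\<pi> \<in> signed_perms m"
  shows "distinct (map abs (window m \<pi>))" "set (map abs (window m \<pi>)) = {1..int m}"
proof -
  have e: "map abs (window m \<pi>) = map (abs_perm m \<pi>) [1..int m]"
    by (auto simp: window_def abs_perm_def)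
  have p: "abs_perm m \<pi> permutes {1..int m}" by (rule abs_perm_permutes[OF assms])
  show "distinct (map abs (window m \<pi>))"
    unfolding e using permutes_inj_on[OF p] by (simp add: distinct_map)
  show "set (map abs (window m \<pi>)) = {1..int m}"
    unfolding e using permutes_image[OF p] by simp
qed

lemma sort_perm_props:
  assumes "\<pi> \<in> signed_perms m"
  shows "sort_perm m \<pi> \<in> signed_perms m"
    and "window m (sort_perm m \<pi>) = sort (window m \<pi>)"
    and "strict_mono_on {1..int m} (sort_perm m \<pi>)"
    and "evenperm (abs_perm m (sort_perm m \<pi>)) \<longleftrightarrow> even (\<Sum>i \<in> Neg_inv m \<pi>. i - 1)"
proof -
  let ?xs = "sort (window m \<pi>)"
  have len: "length ?xs = m" by simp
  have "mset (map abs ?xs) = mset (map abs (window m \<pi>))" by simp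
  then have d: "distinct (map abs ?xs)" using window_abs(1)[OF assms] mset_eq_imp_distinct_iff by blast
  have a: "set (map abs ?xs) = {1..int (length ?xs)}" using window_abs(2)[OF assms] by simp
  have "distinct ?xs" using d by (simp add: distinct_map)
  then have sw: "sorted_wrt (<) ?xs" by (simp add: strict_sorted_iff)
  show "sort_perm m \<pi> \<in> signed_perms m"
    unfolding sort_perm_def using of_window_signed_perms[OF d a] len by simp
  show w: "window m (sort_perm m \<pi>) = ?xs"
    unfolding sort_perm_def using window_of_window[of ?xs] len by simp
  show "strict_mono_on {1..int m} (sort_perm m \<pi>)"
  proof (rule strict_mono_onI)
    fix i j assume ij: "i \<in> {1..int m}" "j \<in> {1..int m}" "i < j"
    have nth: "sort_perm m \<pi> i = ?xs ! (nat i - 1)" if "i \<in> {1..int m}" for i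
    proof -
      have "int (nat i - 1) + 1 = i" "nat i - 1 < m" using that by auto
      then show ?thesis using nth_window[of "nat i - 1" m "sort_perm m \<pi>"] w by simp
    qed
    have "nat i - 1 < nat j - 1" "nat j - 1 < length ?xs" using ij by auto
    then show "sort_perm m \<pi> i < sort_perm m \<pi> j"
      using sorted_wrt_nth_less[OF sw] nth ij by simp
  qed
  show "evenperm (abs_perm m (sort_perm m \<pi>)) \<longleftrightarrow> even (\<Sum>i \<in> Neg_inv m \<pi>. i - 1)"
    using evenperm_sorted_window[OF sw d a] len unfolding sort_perm_def Neg_inv_window by simp
qed

lemma s_map_props:
  assumes "\<pi> \<in> signed_perms (n + 1)" "n > 0"
  shows "s_map n \<pi> \<in> signed_even_perms (n + 1)"
    and "set (window (n + 1) (s_map n \<pi>)) = set (window (n + 1) \<pi>)"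
proof -
  note P = sort_perm_props[OF assms(1)]
  have g: "gen_s 1 \<in> pos_perms (n + 1)" using assms(2) by (intro gen_s_pos_perms) auto
  have "\<not> evenperm (abs_perm (n + 1) (gen_s 1))" using assms(2) by (intro not_evenperm_gen_s) auto
  then show "s_map n \<pi> \<in> signed_even_perms (n + 1)"
    using P(1,4) pos_perms_signed[OF g] evenperm_abs_perm_comp[OF P(1) pos_perms_signed[OF g]]
      signed_perms_comp[OF P(1) pos_perms_signed[OF g]]
    unfolding s_map_def signed_even_perms_def by auto
  show "set (window (n + 1) (s_map n \<pi>)) = set (window (n + 1) \<pi>)"
    unfolding s_map_def using set_window_comp_pos_perms[OF g] P(2) by simp
qed

text \<open>Window entries are distinct, so sorting depends only on their set, and so does the
  parity test. As \<open>Theta\<close> will preserve this set, equal images have equal sorting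
  factors.\<close>

lemma s_map_cong:
  assumes "\<pi> \<in> signed_perms (n + 1)" "\<pi>' \<in> signed_perms (n + 1)"
    "set (window (n + 1) \<pi>) = set (window (n + 1) \<pi>')"
  shows "s_map n \<pi> = s_map n \<pi>'"
proof -
  have "sort (window (n + 1) \<pi>) = sort (window (n + 1) \<pi>')"
    using assms distinct_window
    by (metis sorted_list_of_set_sort_remdups distinct_remdups_id)
  then show ?thesis unfolding s_map_def sort_perm_def Neg_inv_window using assms(3) by simp
qed

text \<open>An increasing map commutes with a pass. If \<open>s_map\<close> also contains
  \<open>s_1\<close>, this acts on the values of \<open>\<tau>\<close> and exchanges the two
  smallest letters 1 and 2, which a pass does not distinguish.\<close>

lemma bubble_window_s_map_comp:
  assumes "\<pi> \<in> signed_perms (n + 1)" "\<tau> \<in> pos_perms (n + 1)" "n > 0"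
  shows "bubble (window (n + 1) (s_map n \<pi> \<circ> \<tau>)) =
    map (sort_perm (n + 1) \<pi>) (bubble (window (n + 1) \<tau>))"
proof -
  let ?q = "sort_perm (n + 1) \<pi>" and ?w = "window (n + 1)"
  have mono: "strict_mono_on {1..int (n + 1)} ?q" using sort_perm_props(3)[OF assms(1)] .
  have set: "set (?w \<rho>) = {1..int (n + 1)}" if "\<rho> \<in> pos_perms (n + 1)" for \<rho>
    using pos_perms_image[OF that] by (simp add: set_window)
  have q: "bubble (?w (?q \<circ> \<rho>)) = map ?q (bubble (?w \<rho>))" if "\<rho> \<in> pos_perms (n + 1)" for \<rho>
    unfolding window_comp using set[OF that] by (intro bubble_map_strict_mono_on[OF mono]) simp
  have g: "gen_s 1 \<circ> \<tau> \<in> pos_perms (n + 1)"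
    using assms(2,3) by (intro pos_perms_comp gen_s_pos_perms) auto
  have "?w (gen_s 1 \<circ> \<tau>) = map (transpose 1 2) (?w \<tau>)"
    unfolding window_comp using set[OF assms(2)]
    by (intro map_cong) (auto simp: gen_s_eq transpose_def)
  moreover have "bubble (map (transpose 1 2) (?w \<tau>)) = bubble (?w \<tau>)"
    using set[OF assms(2)] distinct_window[OF pos_perms_signed[OF assms(2)]] assms(3)
    by (intro bubble_transpose_min) auto
  ultimately show ?thesis
    using q[OF assms(2)] q[OF g] by (simp add: s_map_def comp_assoc)
qed

text \<open>The two windows have the same set of values, so the quotient sends positive positions to
  positive ones; its parity is even because both elements are signed even.\<close>

lemma s_map_decomp:
  assumes "\<pi> \<in> signed_even_perms (n + 1)" "n > 0"
  shows "inv (s_map n \<pi>) \<circ> \<pi> \<in> alt_perms (n + 1)" "\<pi> = s_map n \<pi> \<circ> (inv (s_map n \<pi>) \<circ> \<pi>)"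
proof -
  let ?s = "s_map n \<pi>"
  have p: "\<pi> \<in> signed_perms (n + 1)" using assms(1) by (simp add: signed_even_perms_def)
  note S = s_map_props[OF p assms(2)]
  have s: "?s \<in> signed_perms (n + 1)" using S(1) by (simp add: signed_even_perms_def)
  have v: "inv ?s \<circ> \<pi> \<in> signed_perms (n + 1)" by (intro signed_perms_comp signed_perms_inv s p)
  have "0 < (inv ?s \<circ> \<pi>) i" if "0 < i" for i
  proof (cases "i \<le> int (n + 1)")
    case True
    then have "\<pi> i \<in> ?s ` {1..int (n + 1)}" using that S(2) by (auto simp: set_window)
    then show ?thesis using signed_permsD(9)[OF s] by auto
  next
    case False
    then show ?thesis using signed_perms_fix[OF v] that by auto
  qed
  then show "inv ?s \<circ> \<pi> \<in> alt_perms (n + 1)"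
    using v evenperm_abs_perm_comp[OF signed_perms_inv[OF s] p] evenperm_abs_perm_inv[OF s] S(1) assms(1)
    by (simp add: alt_perms_def pos_perms_def signed_even_perms_def)
  show "\<pi> = ?s \<circ> (inv ?s \<circ> \<pi>)"
    unfolding comp_assoc[symmetric] signed_permsD(7)[OF s] by simp
qed

lemma Theta_props:
  assumes "\<pi> \<in> signed_even_perms (n + 1)" "n > 0"
  shows "Theta n \<pi> \<in> signed_even_perms (n + 1)"
    and "set (window (n + 1) (Theta n \<pi>)) = set (window (n + 1) \<pi>)"
    and "rmaj n \<pi> = int (word_inv (bubble (window (n + 1) (Theta n \<pi>))))"
proof -
  let ?s = "s_map n \<pi>" and ?w = "window (n + 1)" and ?q = "sort_perm (n + 1) \<pi>"
  define v where "v = inv ?s \<circ> \<pi>"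
  have p: "\<pi> \<in> signed_perms (n + 1)" using assms(1) by (simp add: signed_even_perms_def)
  note S = s_map_props[OF p assms(2)]
  have s: "?s \<in> signed_perms (n + 1)" "evenperm (abs_perm (n + 1) ?s)"
    using S(1) by (auto simp: signed_even_perms_def)
  have v: "v \<in> alt_perms (n + 1)" "\<pi> = ?s \<circ> v" using s_map_decomp[OF assms] by (auto simp: v_def)
  obtain k where k: "n = Suc k" using assms(2) by (cases n) auto
  have psi: "Psi n v \<in> alt_perms (n + 1)"
    "map (\<lambda>x. x - 1) (bubble (?w (Psi n v))) = rev_foata (map (\<lambda>x. x - 1) (bubble (?w v)))"
    using Psi_alt_perms[of v k] v(1) k by auto
  have vp: "v \<in> pos_perms (n + 1)" and pp: "Psi n v \<in> pos_perms (n + 1)"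
    using v(1) psi(1) by (auto simp: alt_perms_def)
  have T: "Theta n \<pi> = ?s \<circ> Psi n v" by (simp only: Theta_def v_def)
  show "Theta n \<pi> \<in> signed_even_perms (n + 1)"
    unfolding T using signed_perms_comp[OF s(1) pos_perms_signed[OF pp]]
      evenperm_abs_perm_comp[OF s(1) pos_perms_signed[OF pp]] s(2) psi(1)
    by (simp add: signed_even_perms_def alt_perms_def)
  show "set (?w (Theta n \<pi>)) = set (?w \<pi>)"
    unfolding T set_window_comp_pos_perms[OF pp] by (rule S(2))
  have mono: "strict_mono_on {1..int (n + 1)} ?q" using sort_perm_props(3)[OF p] .
  have shift: "strict_mono_on UNIV (\<lambda>x::int. x - 1)" by (auto intro: strict_mono_onI)
  have sub: "set (bubble (?w \<rho>)) \<subseteq> {1..int (n + 1)}" if "\<rho> \<in> pos_perms (n + 1)" for \<rho>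
    using set_bubble_subset[of "?w \<rho>"] pos_perms_image[OF that] by (simp add: set_window)
  \<comment> \<open>The sorting factor is removed and the letters are lowered by 1; Foata's theorem
    exchanges \<open>rev_maj\<close> for inversions; then both changes are undone for
    \<open>Theta\<close>.\<close>
  have "rmaj n \<pi> = int (rev_maj (bubble (?w \<pi>)))" by (rule rmaj_bubble[OF p])
  also have "bubble (?w \<pi>) = map ?q (bubble (?w v))"
    using bubble_window_s_map_comp[OF p vp assms(2)] v(2) by simp
  also have "rev_maj \<dots> = rev_maj (bubble (?w v))" by (rule rev_maj_map_strict_mono_on[OF mono sub[OF vp]])
  also have "\<dots> = rev_maj (map (\<lambda>x. x - 1) (bubble (?w v)))"
    by (rule rev_maj_map_strict_mono_on[OF shift, symmetric]) simp
  also have "\<dots> = word_inv (rev_foata (map (\<lambda>x. x - 1) (bubble (?w v))))"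
    using distinct_bubble[OF distinct_window[OF pos_perms_signed[OF vp]]]
    by (intro word_inv_rev_foata[symmetric]) (simp add: distinct_map inj_on_def)
  also have "\<dots> = word_inv (bubble (?w (Psi n v)))"
    unfolding psi(2)[symmetric] by (rule word_inv_map_strict_mono_on[OF shift]) simp
  also have "\<dots> = word_inv (map ?q (bubble (?w (Psi n v))))"
    by (rule word_inv_map_strict_mono_on[OF mono sub[OF pp], symmetric])
  also have "map ?q (bubble (?w (Psi n v))) = bubble (?w (Theta n \<pi>))"
    unfolding T by (rule bubble_window_s_map_comp[OF p pp assms(2), symmetric])
  finally show "rmaj n \<pi> = int (word_inv (bubble (?w (Theta n \<pi>))))" .
qed

lemma Theta_inj_on:
  assumes "n > 0" shows "inj_on (Theta n) (signed_even_perms (n + 1))"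
proof (rule inj_onI)
  fix \<pi> \<pi>' assume L: "\<pi> \<in> signed_even_perms (n + 1)" "\<pi>' \<in> signed_even_perms (n + 1)"
    and eq: "Theta n \<pi> = Theta n \<pi>'"
  have p: "\<pi> \<in> signed_perms (n + 1)" "\<pi>' \<in> signed_perms (n + 1)"
    using L by (auto simp: signed_even_perms_def)
  \<comment> \<open>The common image has the window values of both arguments.\<close>
  have s: "s_map n \<pi>' = s_map n \<pi>"
    using Theta_props(2)[OF L(1) assms] Theta_props(2)[OF L(2) assms] eq
    by (intro s_map_cong p) simp
  define v where "v = inv (s_map n \<pi>) \<circ> \<pi>"
  define v' where "v' = inv (s_map n \<pi>) \<circ> \<pi>'"
  have v: "v \<in> alt_perms (n + 1)" "\<pi> = s_map n \<pi> \<circ> v"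
    using s_map_decomp[OF L(1) assms] by (auto simp: v_def)
  have v': "v' \<in> alt_perms (n + 1)" "\<pi>' = s_map n \<pi> \<circ> v'"
    using s_map_decomp[OF L(2) assms] unfolding s by (auto simp: v'_def)
  have si: "inj (s_map n \<pi>)"
    using s_map_props(1)[OF p(1) assms] signed_permsD(3) by (auto simp: signed_even_perms_def)
  have "s_map n \<pi> \<circ> Psi n v = s_map n \<pi> \<circ> Psi n v'"
    using eq unfolding Theta_def s v_def v'_def .
  then have "Psi n v = Psi n v'" using si by (simp add: fun.inj_map_strong inj_def fun_eq_iff)
  moreover obtain k where "n = Suc k" using assms by (cases n) auto
  ultimately have "v = v'" using Psi_inject[of v k v'] v(1) v'(1) by simp
  then show "\<pi> = \<pi>'" using v(2) v'(2) by metis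
qed

lemma finite_signed_even_perms: "finite (signed_even_perms m)"
  by (rule finite_subset[OF _ finite_permutations[of "{- int m..int m} - {0}"]])
    (auto simp: signed_even_perms_def signed_perms_def)

theorem theorem4p2:
  fixes n :: nat
  assumes "n > 0"
  shows "bij_betw (Theta n) (signed_even_perms (n + 1)) (signed_even_perms (n + 1))
    \<and> (\<forall>\<pi> \<in> signed_even_perms (n + 1).
          nrmaj n \<pi> = ell_L (n + 1) (Theta n \<pi>)
          \<and> Neg_inv (n + 1) \<pi> = Neg_inv (n + 1) (Theta n \<pi>))"
proof (intro conjI ballI)
  have "Theta n ` signed_even_perms (n + 1) \<subseteq> signed_even_perms (n + 1)"
    using Theta_props(1) assms by blast
  then show "bij_betw (Theta n) (signed_even_perms (n + 1)) (signed_even_perms (n + 1))"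
    using Theta_inj_on[OF assms] finite_signed_even_perms endo_inj_surj
    unfolding bij_betw_def by blast
next
  fix \<pi> assume L: "\<pi> \<in> signed_even_perms (n + 1)"
  note T = Theta_props[OF L assms]
  show neg: "Neg_inv (n + 1) \<pi> = Neg_inv (n + 1) (Theta n \<pi>)"
    unfolding Neg_inv_window T(2) ..
  have "Theta n \<pi> \<in> signed_perms (n + 1)" using T(1) by (simp add: signed_even_perms_def)
  then show "nrmaj n \<pi> = ell_L (n + 1) (Theta n \<pi>)"
    using ell_L_bubble[of "Theta n \<pi>" "n + 1"] T(3) neg by (simp add: nrmaj_def)
qed

end
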